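(* Let $b$ be a prime, $s,m\in\mathbb{N}$, $p\in\mathbb{F}_b[x]$ with $\deg(p)=m$, and $\boldsymbol{q}\in(G_m\setminus\{0\})^s$. For any real $\alpha,\alpha'>1/2$ and any families $\boldsymbol{\gamma}=(\gamma_u)_u$, $\boldsymbol{\gamma}'=(\gamma'_u)_u$ of non-negative real weights, $$P_{\alpha',\boldsymbol{\gamma}',b^m}(\boldsymbol{q})\le\bigl(\rho_{\alpha,\boldsymbol{\gamma},b^m}(\boldsymbol{q})\bigr)^{\alpha'/\alpha}\sum_{\emptyset\ne u\subseteq\{1,\ldots,s\}}\frac{\gamma'_u}{\gamma_u^{\alpha'/\alpha}}\left(\frac{b^{2\alpha'-1}(b-1)}{b^{2\alpha'-1}-1}\right)^{|u|}(m+1)^{|u|-1}.$$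
   Context: $\mathbb{N}$ is the set of positive integers; $\mathbb{F}_b$ is the field with $b$ elements, identified with $\{0,\ldots,b-1\}$; $G_m=\{g\in\mathbb{F}_b[x]:\deg(g)<m\}$ (including $0$). Weights are families $\boldsymbol{\gamma}=(\gamma_u)$ of non-negative reals indexed by the finite non-empty subsets $u\subset\mathbb{N}$. For an integer $k\ge0$ with $b$-adic expansion $k=\kappa_0+\kappa_1b+\cdots$ let $\mathrm{tr}_m(k)=\kappa_0+\kappa_1x+\cdots+\kappa_{m-1}x^{m-1}\in G_m$. For $k=\kappa_0+\cdots+\kappa_{a-1}b^{a-1}\in\mathbb{N}$ with $\kappa_{a-1}\ne0$ let $\mu(k)=a$; for $\boldsymbol{k}_u=(k_j)_{j\in u}\in\mathbb{N}^{|u|}$ let $\mu(\boldsymbol{k}_u)=\sum_{j\in u}\mu(k_j)$ and $r_\alpha(\boldsymbol{\gamma},\boldsymbol{k}_u)=\gamma_u b^{-2\alpha\mu(\boldsymbol{k}_u)}$. For non-empty $u\subseteq\{1,\ldots,s\}$ let $$P_u^\perp(p,\boldsymbol{q})=\Bigl\{\boldsymbol{k}_u\in\mathbb{N}^{|u|}:\sum_{j\in u}\mathrm{tr}_m(k_j)\,q_j\equiv0 \pmod p\Bigr\},$$ and define (with $p$ suppressed in the notation) $$P_{\alpha,\boldsymbol{\gamma},b^m}(\boldsymbol{q})=\sum_{\emptyset\ne u\subseteq\{1,\ldots,s\}}\ \sum_{\boldsymbol{k}_u\in P_u^\perp(p,\boldsymbol{q})}r_\alpha(\boldsymbol{\gamma},\boldsymbol{k}_u),\qquad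 \rho_{\alpha,\boldsymbol{\gamma},b^m}(\boldsymbol{q})=\max_{\emptyset\ne u\subseteq\{1,\ldots,s\}}\ \max_{\boldsymbol{k}_u\in P_u^\perp(p,\boldsymbol{q})}r_\alpha(\boldsymbol{\gamma},\boldsymbol{k}_u).$$ ($P_{\alpha,\boldsymbol{\gamma},b^m}(\boldsymbol{q})$ is the squared worst-case error of the polynomial lattice rule with modulus $p$ and generating vector $\boldsymbol{q}$ in the weighted Walsh space with smoothness $\alpha$ and weights $\boldsymbol{\gamma}$.) Convention: $0/0=0$; if $\gamma_u=0<\gamma'_u$ for some non-empty $u\subseteq\{1,\ldots,s\}$, the right-hand side is read as $+\infty$. *)

theory Defs
  imports
    "HOL-Analysis.Analysis"
    "HOL-Computational_Algebra.Computational_Algebra"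
    "HOL-Number_Theory.Cong"
begin

(* The finite field with b elements is a type 'f :: {field, finite} with CARD('f) = b;
   for prime b, of_nat restricted to {0..<b} is the identification of {0,...,b-1} with
   the field.  Vectors indexed by a finite set u of positive integers are functions on nat
   that are extensional on u (elements of a PiE set). *)

definition digit :: "nat \<Rightarrow> nat \<Rightarrow> nat \<Rightarrow> nat" where
  "digit b k i = k div b ^ i mod b"

definition G_poly :: "nat \<Rightarrow> 'f::field poly set" where
  "G_poly m = {g. g = 0 \<or> degree g < m}"

definition tr :: "nat \<Rightarrow> nat \<Rightarrow> nat \<Rightarrow> 'f::field poly" where
  "tr b m k = (\<Sum>i<m. monom (of_nat (digit b k i)) i)"

(* Only used for b \<ge> 2 and k \<ge> 1, where the set is finite and non-empty. *)
definition mu :: "nat \<Rightarrow> nat \<Rightarrow> nat" where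
  "mu b k = Suc (Max {i. digit b k i \<noteq> 0})"

definition mu_vec :: "nat \<Rightarrow> nat set \<Rightarrow> (nat \<Rightarrow> nat) \<Rightarrow> nat" where
  "mu_vec b u k = (\<Sum>j\<in>u. mu b (k j))"

definition r_val :: "nat \<Rightarrow> real \<Rightarrow> (nat set \<Rightarrow> real) \<Rightarrow> nat set \<Rightarrow> (nat \<Rightarrow> nat) \<Rightarrow> real" where
  "r_val b \<alpha> \<gamma> u k = \<gamma> u * real b powr (- 2 * \<alpha> * real (mu_vec b u k))"

definition dual_net ::
  "nat \<Rightarrow> nat \<Rightarrow> 'f::field poly \<Rightarrow> (nat \<Rightarrow> 'f poly) \<Rightarrow> nat set \<Rightarrow> (nat \<Rightarrow> nat) set" where
  "dual_net b m p q u =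
     {k \<in> u \<rightarrow>\<^sub>E {1..}. [(\<Sum>j\<in>u. tr b m (k j) * q j) = 0] (mod p)}"

definition index_sets :: "nat \<Rightarrow> nat set set" where
  "index_sets s = {u. u \<noteq> {} \<and> u \<subseteq> {1..s}}"

(* Taken in [0,\<infinity>], so that the sum of non-negative terms never defaults to 0. *)
definition P_err ::
  "nat \<Rightarrow> nat \<Rightarrow> nat \<Rightarrow> 'f::field poly \<Rightarrow> real \<Rightarrow> (nat set \<Rightarrow> real) \<Rightarrow> (nat \<Rightarrow> 'f poly) \<Rightarrow> ennreal"
where
  "P_err b s m p \<alpha> \<gamma> q =
     (\<Sum>u\<in>index_sets s. \<Sum>\<^sub>\<infinity>k\<in>dual_net b m p q u. ennreal (r_val b \<alpha> \<gamma> u k))"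

(* The inner supremum over the infinite dual net is a maximum, see r_max_attained. *)
definition rho ::
  "nat \<Rightarrow> nat \<Rightarrow> nat \<Rightarrow> 'f::field poly \<Rightarrow> real \<Rightarrow> (nat set \<Rightarrow> real) \<Rightarrow> (nat \<Rightarrow> 'f poly) \<Rightarrow> real"
where
  "rho b s m p \<alpha> \<gamma> q =
     (MAX u\<in>index_sets s. SUP k\<in>dual_net b m p q u. r_val b \<alpha> \<gamma> u k)"

lemma dual_net_nonempty:
  assumes "b \<ge> 2"
  shows "dual_net b m p q u \<noteq> {}"
proof -
  have d: "digit b (b ^ m) i = 0" if "i < m" for i
  proof -
    have "b ^ m = b ^ (i + (1 + (m - i - 1)))"
      using that by simp
    also have "\<dots> = b ^ i * (b * b ^ (m - i - 1))"
      by (simp only: power_add power_one_right)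
    finally have "b ^ m = b ^ i * (b * b ^ (m - i - 1))" .
    then show ?thesis using assms by (simp add: digit_def)
  qed
  have "tr b m (b ^ m) = (0 :: 'a poly)"
    by (simp add: tr_def d)
  then have "(\<lambda>j\<in>u. b ^ m) \<in> dual_net b m p q u"
    using assms by (auto simp: dual_net_def Suc_le_eq)
  then show ?thesis by blast
qed

lemma r_max_attained:
  assumes "b \<ge> 2" "\<alpha> > 0" "\<gamma> u \<ge> 0"
  obtains k where "k \<in> dual_net b m p q u"
    and "\<And>l. l \<in> dual_net b m p q u \<Longrightarrow> r_val b \<alpha> \<gamma> u l \<le> r_val b \<alpha> \<gamma> u k"
    and "(SUP l\<in>dual_net b m p q u. r_val b \<alpha> \<gamma> u l) = r_val b \<alpha> \<gamma> u k"
proof -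
  obtain k where k: "k \<in> dual_net b m p q u"
    and min: "\<And>l. l \<in> dual_net b m p q u \<Longrightarrow> mu_vec b u k \<le> mu_vec b u l"
    using dual_net_nonempty[OF assms(1), of m p q u]
      ex_has_least_nat[of "\<lambda>l. l \<in> dual_net b m p q u" _ "mu_vec b u"] by blast
  have le: "r_val b \<alpha> \<gamma> u l \<le> r_val b \<alpha> \<gamma> u k" if "l \<in> dual_net b m p q u" for l
  proof -
    have "- 2 * \<alpha> * real (mu_vec b u l) \<le> - 2 * \<alpha> * real (mu_vec b u k)"
      using assms(2) min[OF that] by simp
    then have "real b powr (- 2 * \<alpha> * real (mu_vec b u l))
        \<le> real b powr (- 2 * \<alpha> * real (mu_vec b u k))"
      by (rule powr_mono) (use assms(1) in simp)
    then show ?thesis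
      unfolding r_val_def using assms(3) by (rule mult_left_mono)
  qed
  have "(SUP l\<in>dual_net b m p q u. r_val b \<alpha> \<gamma> u l) = r_val b \<alpha> \<gamma> u k"
    using k le by (intro cSup_eq_maximum) auto
  with k le show ?thesis by (rule that)
qed

end

theory Submission
  imports Defs "HOL-Library.Function_Algebras"
begin

text \<open>Replacing \<open>x\<^sup>m\<close> by \<open>p\<close> in the digit polynomial of \<open>k\<close> identifies the dual net of \<open>u\<close> with
  the vectors without zero entries in the module \<open>L = {g. \<Sum> g\<^sub>j q\<^sub>j \<equiv> 0 mod p}\<close>, and \<open>\<mu>\<close> becomes
  the sum of the lengths \<open>degree + 1\<close>. Let \<open>M\<close> be the least such sum and \<open>n = card u\<close>. A coordinatewise
  division argument gives \<open>M \<le> n + m\<close>. It then suffices to bound the number of vectors of weight \<open>M + \<tau>\<close> by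
  \<open>(b - 1)\<^sup>n b\<^sup>\<tau> (\<tau> + n - 1 choose n - 1) (m + 1)\<^sup>n\<^sup>-\<^sup>1\<close> and to sum the negative binomial series.

  Vectors are sorted into cells by the lengths \<open>a\<close> of their entries. Two vectors of the same cell may
  differ by a vector with zero entries, so minimality of \<open>M\<close> does not bound a cell by
  \<open>(b - 1)\<^sup>n b\<^sup>\<tau>\<close> directly. Instead one shrinks the box \<open>a\<close> until every full vector in it attains all the
  lengths; such a tight box has dimension at most \<open>n\<close>. This bounds a cell up to a factor \<open>2\<^sup>E\<close>, which is
  absorbed by the gap between the number of cells and \<open>(m + 1)\<^sup>n\<^sup>-\<^sup>1\<close>, except for \<open>b = 2\<close>, \<open>n = 3\<close>, \<open>\<tau> = 0\<close>,
  where the few cells with two vectors are counted separately.\<close>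

section \<open>Lengths of polynomials\<close>

text \<open>The polynomial counterpart of \<open>mu\<close>. The value 0 at the zero polynomial
  makes \<open>len g \<le> a\<close> a linear condition that cuts out a space of dimension
  \<open>a\<close>.\<close>

definition len :: "'a::zero poly \<Rightarrow> nat" where
  "len g = (if g = 0 then 0 else Suc (degree g))"

lemma len_0 [simp]: "len 0 = 0"
  by (simp add: len_def)

lemma len_eq_0_iff [simp]: "len g = 0 \<longleftrightarrow> g = 0"
  by (simp add: len_def)

lemma len_pos_iff [simp]: "0 < len g \<longleftrightarrow> g \<noteq> 0"
  by (simp add: len_def)

lemma len_le_iff: "len g \<le> a \<longleftrightarrow> (\<forall>i\<ge>a. coeff g i = 0)"
proof
  assume "len g \<le> a"
  then show "\<forall>i\<ge>a. coeff g i = 0"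
    by (auto simp: len_def coeff_eq_0 split: if_splits)
next
  assume r: "\<forall>i\<ge>a. coeff g i = 0"
  show "len g \<le> a"
  proof (cases "g = 0")
    case False
    then have "coeff g (degree g) \<noteq> 0" by simp
    then have "degree g < a" using r not_le by blast
    then show ?thesis using False by (simp add: len_def)
  qed simp
qed

lemma coeff_len_eq_0: "len g \<le> a \<Longrightarrow> a \<le> i \<Longrightarrow> coeff g i = 0"
  by (simp add: len_le_iff)

lemma len_le_pred_iff:
  assumes "len g \<le> a"
  shows "len g \<le> a - 1 \<longleftrightarrow> coeff g (a - 1) = 0"
proof (cases a)
  case 0 then show ?thesis using assms by auto
next
  case (Suc c)
  have "(\<forall>i\<ge>c. coeff g i = 0) \<longleftrightarrow> coeff g c = 0 \<and> (\<forall>i\<ge>Suc c. coeff g i = 0)"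
    by (metis Suc_leD Suc_leI le_eq_less_or_eq le_refl)
  then show ?thesis using assms by (auto simp: Suc len_le_iff)
qed

lemma len_eq_iff_coeff:
  assumes "len g \<le> a" "1 \<le> a"
  shows "len g = a \<longleftrightarrow> coeff g (a - 1) \<noteq> 0"
  using len_le_pred_iff[OF assms(1)] assms by auto

lemma len_diff_le: "len g \<le> a \<Longrightarrow> len h \<le> a \<Longrightarrow> len (g - h) \<le> (a::nat)"
  for g h :: "'a::ab_group_add poly"
  by (simp add: len_le_iff)

lemma len_add_le: "len g \<le> a \<Longrightarrow> len h \<le> a \<Longrightarrow> len (g + h) \<le> (a::nat)"
  for g h :: "'a::comm_monoid_add poly"
  by (simp add: len_le_iff)

lemma len_mult: "f \<noteq> 0 \<Longrightarrow> g \<noteq> 0 \<Longrightarrow> len (f * g) = len f + len g - 1"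
  for f g :: "'a::idom poly"
  by (simp add: len_def degree_mult_eq)

lemma len_monom_mult: "c \<noteq> 0 \<Longrightarrow> g \<noteq> 0 \<Longrightarrow> len (monom c l * g) = len g + l"
  for g :: "'a::idom poly"
  by (simp add: len_mult) (simp add: len_def degree_monom_eq)

lemma card_len_le:
  "finite {g :: 'f::{zero,finite} poly. len g \<le> a} \<and>
   card {g :: 'f poly. len g \<le> a} = CARD('f) ^ a"
proof (induction a)
  case (Suc a)
  have bij: "bij_betw (\<lambda>(c :: 'f, g). pCons c g) (UNIV \<times> {g. len g \<le> a}) {g. len g \<le> Suc a}"
  proof (intro bij_betwI')
    fix y :: "'f poly" assume y: "y \<in> {g. len g \<le> Suc a}"
    obtain c g where "y = pCons c g" by (cases y)
    moreover from this y have "len g \<le> a"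
      by (auto simp: len_le_iff coeff_pCons split: nat.splits)
    ultimately show "\<exists>x\<in>UNIV \<times> {g. len g \<le> a}. y = (\<lambda>(c, g). pCons c g) x" by auto
  next
    fix x assume x: "x \<in> (UNIV :: 'f set) \<times> {g :: 'f poly. len g \<le> a}"
    then show "(\<lambda>(c, g). pCons c g) x \<in> {g. len g \<le> Suc a}"
      by (auto simp: len_le_iff coeff_pCons split: nat.splits)
  qed auto
  have "finite ((UNIV :: 'f set) \<times> {g :: 'f poly. len g \<le> a})" using Suc by simp
  then show ?case
    using bij_betw_finite[OF bij] bij_betw_same_card[OF bij] Suc by (simp add: card_cartesian_product)
qed simp

lemma finite_len_le [simp]: "finite {g :: 'f::{zero,finite} poly. len g \<le> a}"
  using card_len_le by blast

section \<open>Bezout's identity, fibres of equal size, and prime fields\<close>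

lemma poly_bezout:
  fixes f g :: "'f::field poly"
  shows "\<exists>d x y. d = x * f + y * g \<and> d dvd f \<and> d dvd g"
proof (induction "euclidean_size g" arbitrary: f g rule: less_induct)
  case less
  show ?case
  proof (cases "g = 0")
    case True
    then have "f = 1 * f + 0 * g \<and> f dvd f \<and> f dvd g" by simp
    then show ?thesis by blast
  next
    case False
    obtain d x y where d: "d = x * g + y * (f mod g)" "d dvd g" "d dvd f mod g"
      using less[of "f mod g" g] mod_size_less[OF False] by blast
    have "d dvd f" using d(2,3) by (metis dvd_mod_iff)
    moreover have "d = y * f + (x - y * (f div g)) * g"
    proof -
      define r where "r = f mod g"
      have "f = f div g * g + r" by (simp add: r_def)
      then have "y * f = y * (f div g) * g + y * r" by (metis distrib_left mult.assoc)
      then show ?thesis using d(1) by (simp add: r_def[symmetric] algebra_simps)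
    qed
    ultimately show ?thesis using d(2) by blast
  qed
qed

text \<open>Translation by \<open>e\<close> shifts the value of \<open>\<phi>\<close> by
  \<open>c\<close>, so every fibre has the size of the zero fibre. \<open>S\<close> is asked only to
  be stable under such translations, so that sets cut out by nonvanishing conditions
  qualify.\<close>

lemma card_fibre:
  fixes \<phi> :: "'v::ab_group_add \<Rightarrow> 'f::{field,finite}"
  assumes "finite S"
    and tr: "\<And>c. \<exists>e. \<forall>x\<in>S. x + e \<in> S \<and> x - e \<in> S \<and> \<phi> (x + e) = \<phi> x + c \<and> \<phi> (x - e) = \<phi> x - c"
  shows "card {x\<in>S. \<phi> x = c} = card {x\<in>S. \<phi> x = 0}"
    and "card S = CARD('f) * card {x\<in>S. \<phi> x = 0}"
proof -
  show eq: "card {x\<in>S. \<phi> x = c} = card {x\<in>S. \<phi> x = 0}" for c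
  proof -
    obtain e where e: "\<forall>x\<in>S. x + e \<in> S \<and> x - e \<in> S \<and> \<phi> (x + e) = \<phi> x + c \<and> \<phi> (x - e) = \<phi> x - c"
      using tr by blast
    have "bij_betw (\<lambda>x. x - e) {x\<in>S. \<phi> x = c} {x\<in>S. \<phi> x = 0}"
      by (rule bij_betw_byWitness[where f' = "\<lambda>x. x + e"]) (use e in auto)
    then show ?thesis by (rule bij_betw_same_card)
  qed
  have "card S = card (\<Union>c. {x\<in>S. \<phi> x = c})" by (rule arg_cong[where f = card]) auto
  also have "\<dots> = (\<Sum>c\<in>UNIV. card {x\<in>S. \<phi> x = c})"
    by (rule card_UN_disjoint) (use assms(1) in auto)
  also have "\<dots> = (\<Sum>c\<in>(UNIV :: 'f set). card {x\<in>S. \<phi> x = 0})"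
    by (intro sum.cong refl eq)
  finally show "card S = CARD('f) * card {x\<in>S. \<phi> x = 0}" by simp
qed

text \<open>Translation by 1 permutes the field and therefore leaves the sum of all its elements
  fixed.\<close>

lemma of_nat_CARD_eq_0: "of_nat CARD('f) = (0 :: 'f::{field,finite})"
proof -
  have "(\<Sum>x\<in>UNIV. x) = (\<Sum>x\<in>UNIV. x + (1 :: 'f))"
    by (rule sum.reindex_bij_witness[where i = "\<lambda>x. x + 1" and j = "\<lambda>x. x - 1"]) auto
  also have "\<dots> = (\<Sum>x\<in>UNIV. x) + of_nat CARD('f)"
    by (simp only: sum.distrib sum_constant mult_1_right)
  finally show ?thesis by (metis add_cancel_left_right)
qed

text \<open>The characteristic divides the prime \<open>CARD('f)\<close> and is not 1, so the two
  agree.\<close>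

lemma bij_betw_of_nat_prime_field:
  assumes "prime CARD('f::{field,finite})"
  shows "bij_betw of_nat {..<CARD('f)} (UNIV :: 'f set)"
proof -
  have "CHAR('f) dvd CARD('f)"
    using of_nat_CARD_eq_0 by (simp add: of_nat_eq_0_iff_char_dvd)
  then have ch: "CHAR('f) = CARD('f)"
    using assms CHAR_not_1[where ?'a = 'f] by (metis One_nat_def prime_nat_iff)
  have inj: "inj_on (of_nat :: nat \<Rightarrow> 'f) {..<CARD('f)}"
    by (auto simp: inj_on_def of_nat_eq_iff_cong_CHAR ch cong_def)
  then have "of_nat ` {..<CARD('f)} = (UNIV :: 'f set)"
    by (intro card_subset_eq) (auto simp: card_image)
  with inj show ?thesis by (simp add: bij_betw_def)
qed

section \<open>Boxes in a module of polynomial vectors\<close>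

lemma CARD_field_ge_2: "2 \<le> CARD('f::{field,finite})"
proof -
  have "card {0, 1 :: 'f} \<le> CARD('f)" by (rule card_mono) auto
  then show ?thesis by simp
qed

lemma len_le_pred: "len g \<le> a - 1 \<longleftrightarrow> len g \<le> a \<and> coeff g (a - 1) = 0"
  by (meson diff_le_self le_trans len_le_pred_iff)

lemma len_smult_le: "len (smult c g) \<le> len g"
  by (simp add: len_def degree_smult_le)

text \<open>Submodules of the free module on \<open>u\<close>, encoded as functions on
  \<open>nat\<close> that vanish off \<open>u\<close>: pointwise sums and differences of functions
  are then the module operations, and vectors that agree on \<open>u\<close> are equal.\<close>

locale poly_lattice =
  fixes u :: "nat set" and L :: "(nat \<Rightarrow> 'f::{field,finite} poly) set"
  assumes finite_u: "finite u"
    and zero_mem: "0 \<in> L"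
    and diff_mem: "g \<in> L \<Longrightarrow> h \<in> L \<Longrightarrow> g - h \<in> L"
    and scale_mem: "g \<in> L \<Longrightarrow> (\<lambda>j. f * g j) \<in> L"
    and off_u: "g \<in> L \<Longrightarrow> j \<notin> u \<Longrightarrow> g j = 0"
begin

definition box :: "(nat \<Rightarrow> nat) \<Rightarrow> (nat \<Rightarrow> 'f poly) set" where
  "box a = {g\<in>L. \<forall>j\<in>u. len (g j) \<le> a j}"

definition full :: "(nat \<Rightarrow> 'f poly) \<Rightarrow> bool" where
  "full g \<longleftrightarrow> (\<forall>j\<in>u. g j \<noteq> 0)"

text \<open>The dimension of the box over the finite field, read off from its cardinality;
  \<open>ex_dm\<close> shows that the described exponent exists.\<close>

definition dm :: "(nat \<Rightarrow> nat) \<Rightarrow> nat" where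
  "dm a = (THE r. card (box a) = CARD('f) ^ r)"

lemma add_mem: "g \<in> L \<Longrightarrow> h \<in> L \<Longrightarrow> g + h \<in> L"
  using diff_mem[of g "0 - h"] diff_mem[OF zero_mem, of h] by simp

lemma box_L: "g \<in> box a \<Longrightarrow> g \<in> L"
  by (simp add: box_def)

lemma box_len: "g \<in> box a \<Longrightarrow> j \<in> u \<Longrightarrow> len (g j) \<le> a j"
  by (simp add: box_def)

lemma zero_box: "0 \<in> box a"
  by (simp add: box_def zero_mem)

lemma diff_box: "g \<in> box a \<Longrightarrow> h \<in> box a \<Longrightarrow> g - h \<in> box a"
  by (simp add: box_def diff_mem len_diff_le)

lemma add_box: "g \<in> box a \<Longrightarrow> h \<in> box a \<Longrightarrow> g + h \<in> box a"
  by (simp add: box_def add_mem len_add_le)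

lemma smult_box: "g \<in> box a \<Longrightarrow> (\<lambda>j. smult c (g j)) \<in> box a"
  using scale_mem[of g "[:c:]"] len_smult_le[of c] le_trans unfolding box_def by fastforce

lemma box_cong: "(\<And>j. j \<in> u \<Longrightarrow> a j = a' j) \<Longrightarrow> box a = box a'"
  by (simp add: box_def)

lemma box_mono: "(\<And>j. j \<in> u \<Longrightarrow> a j \<le> a' j) \<Longrightarrow> box a \<subseteq> box a'"
  unfolding box_def by (blast intro: le_trans)

lemma finite_box [simp]: "finite (box a)"
proof (rule finite_imageD)
  show "finite ((\<lambda>g. restrict g u) ` box a)"
    by (rule finite_subset[of _ "PiE u (\<lambda>j. {g. len g \<le> a j})"])
       (auto simp: box_def intro!: finite_PiE finite_u)
  show "inj_on (\<lambda>g. restrict g u) (box a)"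
  proof (rule inj_onI, rule ext)
    fix g h j assume "g \<in> box a" "h \<in> box a" and eq: "restrict g u = restrict h u"
    then show "g j = h j"
      by (metis box_L off_u restrict_apply)
  qed
qed

lemma box_pred_on_iff:
  assumes "J \<subseteq> u"
  shows "g \<in> box (\<lambda>i. if i \<in> J then a i - 1 else a i) \<longleftrightarrow>
    g \<in> box a \<and> (\<forall>i\<in>J. coeff (g i) (a i - 1) = 0)"
proof -
  have "len (g i) \<le> (if i \<in> J then a i - 1 else a i) \<longleftrightarrow>
      len (g i) \<le> a i \<and> (i \<in> J \<longrightarrow> coeff (g i) (a i - 1) = 0)" for i
    by (cases "i \<in> J") (simp_all only: len_le_pred if_True if_False simp_thms)
  then have "(\<forall>i\<in>u. len (g i) \<le> (if i \<in> J then a i - 1 else a i)) \<longleftrightarrow>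
      (\<forall>i\<in>u. len (g i) \<le> a i) \<and> (\<forall>i\<in>J. coeff (g i) (a i - 1) = 0)"
    using assms by blast
  then show ?thesis unfolding box_def by simp
qed

lemma box_pred_iff:
  assumes "j \<in> u"
  shows "g \<in> box (a(j := a j - 1)) \<longleftrightarrow> g \<in> box a \<and> coeff (g j) (a j - 1) = 0"
proof -
  have "box (a(j := a j - 1)) = box (\<lambda>i. if i \<in> {j} then a i - 1 else a i)"
    by (rule box_cong) auto
  then show ?thesis using box_pred_on_iff[of "{j}" g a] assms by simp
qed

lemma box_pred_all_iff:
  "g \<in> box (\<lambda>j. a j - 1) \<longleftrightarrow> g \<in> box a \<and> (\<forall>j\<in>u. coeff (g j) (a j - 1) = 0)"
proof -
  have "box (\<lambda>j. a j - 1) = box (\<lambda>i. if i \<in> u then a i - 1 else a i)"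
    by (rule box_cong) simp
  then show ?thesis using box_pred_on_iff[of u g a] by simp
qed

text \<open>Translation by multiples of \<open>e\<close> preserves \<open>S\<close>: it leaves the
  coefficients tested on \<open>J\<close> unchanged and moves the one at \<open>j\<close> by any
  prescribed amount. So the coefficient at \<open>j\<close> is equidistributed on
  \<open>S\<close>.\<close>

lemma box_split:
  assumes j: "j \<in> u" "j \<notin> J" and e: "e \<in> box a" "\<And>i. i \<in> J \<Longrightarrow> coeff (e i) (a i - 1) = 0"
    and ej: "coeff (e j) (a j - 1) \<noteq> 0"
    and S: "S = {w\<in>box a. \<forall>i\<in>J. coeff (w i) (a i - 1) \<noteq> 0}"
  shows "card S = CARD('f) * card {w\<in>S. coeff (w j) (a j - 1) = 0}"
    and "card {w\<in>S. coeff (w j) (a j - 1) \<noteq> 0} =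
      (CARD('f) - 1) * card {w\<in>S. coeff (w j) (a j - 1) = 0}"
proof -
  have fin: "finite S" by (simp add: S)
  show *: "card S = CARD('f) * card {w\<in>S. coeff (w j) (a j - 1) = 0}"
  proof (rule card_fibre(2)[OF fin])
    fix c
    define h where "h = (\<lambda>i. smult (c / coeff (e j) (a j - 1)) (e i))"
    have "h \<in> box a" unfolding h_def by (rule smult_box[OF e(1)])
    moreover have "coeff (h i) (a i - 1) = 0" if "i \<in> J" for i
      using e(2)[OF that] by (simp add: h_def)
    moreover have "coeff (h j) (a j - 1) = c" using ej by (simp add: h_def)
    ultimately have "\<forall>x\<in>S. x + h \<in> S \<and> x - h \<in> S \<and>
        coeff ((x + h) j) (a j - 1) = coeff (x j) (a j - 1) + c \<and>
        coeff ((x - h) j) (a j - 1) = coeff (x j) (a j - 1) - c"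
      by (auto simp: S add_box diff_box)
    then show "\<exists>e. \<forall>x\<in>S. x + e \<in> S \<and> x - e \<in> S \<and>
        coeff ((x + e) j) (a j - 1) = coeff (x j) (a j - 1) + c \<and>
        coeff ((x - e) j) (a j - 1) = coeff (x j) (a j - 1) - c" by blast
  qed
  have "{w\<in>S. coeff (w j) (a j - 1) \<noteq> 0} = S - {w\<in>S. coeff (w j) (a j - 1) = 0}" by auto
  then have "card {w\<in>S. coeff (w j) (a j - 1) \<noteq> 0} =
      card S - card {w\<in>S. coeff (w j) (a j - 1) = 0}"
    using fin by (simp add: card_Diff_subset)
  then show "card {w\<in>S. coeff (w j) (a j - 1) \<noteq> 0} =
      (CARD('f) - 1) * card {w\<in>S. coeff (w j) (a j - 1) = 0}"
    by (simp add: * diff_mult_distrib)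
qed

text \<open>Lowering one length bound imposes one linear condition, the vanishing of a top
  coefficient. Either it holds on the whole box or it divides the cardinality by that of the
  field.\<close>

lemma box_step_cases:
  assumes j: "j \<in> u"
  shows "box (a(j := a j - 1)) = box a \<or>
    card (box a) = CARD('f) * card (box (a(j := a j - 1)))"
proof (cases "\<exists>e\<in>box a. coeff (e j) (a j - 1) \<noteq> 0")
  case True
  then obtain e where "e \<in> box a" "coeff (e j) (a j - 1) \<noteq> 0" by blast
  moreover have "{w\<in>box a. coeff (w j) (a j - 1) = 0} = box (a(j := a j - 1))"
    using box_pred_iff[OF j] by blast
  ultimately show ?thesis using box_split(1)[of j "{}" e a "box a"] j by simp
next
  case False
  then show ?thesis using box_pred_iff[OF j] by blast
qed

lemma ex_dm: "\<exists>r. card (box a) = CARD('f) ^ r"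
proof (induction "\<Sum>j\<in>u. a j" arbitrary: a rule: less_induct)
  case less
  show ?case
  proof (cases "\<exists>j\<in>u. 0 < a j")
    case True
    then obtain j where j: "j \<in> u" "0 < a j" by blast
    have "(\<Sum>i\<in>u. (a(j := a j - 1)) i) < (\<Sum>i\<in>u. a i)"
      by (rule sum_strict_mono_ex1) (use j finite_u in auto)
    then obtain r where "card (box (a(j := a j - 1))) = CARD('f) ^ r" using less by blast
    then show ?thesis using box_step_cases[OF j(1), of a] by (metis power_Suc)
  next
    case False
    have "g = 0" if "g \<in> box a" for g
    proof
      fix i show "g i = 0 i"
        using that False off_u[OF box_L[OF that], of i] by (cases "i \<in> u") (auto simp: box_def)
    qed
    then have "box a = {0}" using zero_box by blast
    then show ?thesis by (intro exI[of _ 0]) simp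
  qed
qed

lemma card_box: "card (box a) = CARD('f) ^ dm a"
proof -
  have "\<exists>!r. card (box a) = CARD('f) ^ r"
    using ex_dm[of a] CARD_field_ge_2[where ?'f = 'f] by (auto simp: power_inject_exp)
  then show ?thesis unfolding dm_def by (rule theI')
qed

lemma dm_le_iff: "card (box a) \<le> CARD('f) ^ r \<longleftrightarrow> dm a \<le> r"
  using CARD_field_ge_2[where ?'f = 'f] by (simp add: card_box)

lemma dm_eq_iff: "card (box a) = CARD('f) ^ r \<longleftrightarrow> dm a = r"
  using CARD_field_ge_2[where ?'f = 'f] by (auto simp: card_box)

lemma dm_mono: "(\<And>j. j \<in> u \<Longrightarrow> a j \<le> a' j) \<Longrightarrow> dm a \<le> dm a'"
  using card_mono[OF finite_box box_mono, of a a'] dm_le_iff[of a "dm a'"] by (simp add: card_box)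

lemma dm_step_cases:
  assumes "j \<in> u"
  shows "box (a(j := a j - 1)) = box a \<or> dm a = Suc (dm (a(j := a j - 1)))"
proof -
  have "dm a = Suc (dm (a(j := a j - 1)))" if "box (a(j := a j - 1)) \<noteq> box a"
    using box_step_cases[OF assms, of a] that
    unfolding card_box[of "a(j := a j - 1)"] power_Suc[symmetric] dm_eq_iff by blast
  then show ?thesis by blast
qed

lemma dm_step: "j \<in> u \<Longrightarrow> dm a \<le> Suc (dm (a(j := a j - 1)))"
  using dm_step_cases[of j a] by (auto simp: dm_def)

text \<open>The bounds are lowered by one at a time, and each step costs at most one
  dimension.\<close>

lemma dm_le_add:
  "(\<And>j. j \<in> u \<Longrightarrow> a' j \<le> a j) \<Longrightarrow> dm a \<le> dm a' + (\<Sum>j\<in>u. a j - a' j)"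
proof (induction "\<Sum>j\<in>u. a j - a' j" arbitrary: a rule: less_induct)
  case less
  show ?case
  proof (cases "\<exists>j\<in>u. a' j < a j")
    case True
    then obtain j where j: "j \<in> u" "a' j < a j" by blast
    define a1 where "a1 = a(j := a j - 1)"
    have "(\<Sum>i\<in>u. a1 i - a' i) + 1 = (\<Sum>i\<in>u. a i - a' i)"
    proof -
      have "(\<Sum>i\<in>u - {j}. a1 i - a' i) = (\<Sum>i\<in>u - {j}. a i - a' i)"
        by (rule sum.cong) (auto simp: a1_def)
      then show ?thesis using j finite_u by (simp add: sum.remove a1_def)
    qed
    moreover have "a' i \<le> a1 i" if "i \<in> u" for i
      using less.prems[OF that] j by (auto simp: a1_def)
    ultimately have "dm a1 \<le> dm a' + (\<Sum>i\<in>u. a1 i - a' i)" using less.hyps by simp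
    then show ?thesis using dm_step[OF j(1), of a] \<open>_ = (\<Sum>i\<in>u. a i - a' i)\<close>
      by (simp add: a1_def)
  next
    case False
    then have "box a = box a'" using less.prems by (intro box_cong) (meson le_antisym not_le)
    then show ?thesis by (simp add: dm_def)
  qed
qed

text \<open>The top coefficients are required to be nonzero coordinate by coordinate. If the one at
  the new \<open>j\<close> is not identically zero on \<open>box (aJ J)\<close>, the fraction
  (b-1)/b of \<open>S J\<close> survives and the dimension drops by one. Otherwise the dimension
  stays and the count does not grow.\<close>

lemma card_cell_le:
  assumes "\<And>j. j \<in> u \<Longrightarrow> 1 \<le> a j"
  shows "card {w\<in>L. \<forall>j\<in>u. len (w j) = a j} \<le>
    (CARD('f) - 1) ^ (dm a - dm (\<lambda>j. a j - 1)) * CARD('f) ^ dm (\<lambda>j. a j - 1)"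
proof -
  define S where "S J = {w\<in>box a. \<forall>i\<in>J. coeff (w i) (a i - 1) \<noteq> 0}" for J
  define aJ where "aJ J = (\<lambda>i. if i \<in> J then a i - 1 else a i)" for J
  have "card (S J) \<le> (CARD('f) - 1) ^ (dm a - dm (aJ J)) * CARD('f) ^ dm (aJ J)"
    if "finite J" "J \<subseteq> u" for J
    using that
  proof (induction J rule: finite_induct)
    case empty
    then show ?case by (simp add: S_def aJ_def card_box)
  next
    case (insert j J)
    have j: "j \<in> u" using insert by simp
    have aJ: "aJ (insert j J) = (aJ J)(j := aJ J j - 1)" "aJ J j = a j"
      using insert by (auto simp: aJ_def)
    have box_aJ: "e \<in> box (aJ J) \<longleftrightarrow> e \<in> box a \<and> (\<forall>i\<in>J. coeff (e i) (a i - 1) = 0)" for e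
      unfolding aJ_def using box_pred_on_iff[of J e a] insert.prems by blast
    have IH: "card (S J) \<le> (CARD('f) - 1) ^ (dm a - dm (aJ J)) * CARD('f) ^ dm (aJ J)"
      using insert by simp
    have Sj: "S (insert j J) = {w\<in>S J. coeff (w j) (a j - 1) \<noteq> 0}" by (auto simp: S_def)
    show ?case
    proof (cases "\<exists>e\<in>box (aJ J). coeff (e j) (a j - 1) \<noteq> 0")
      case True
      then obtain e where e: "e \<in> box (aJ J)" "coeff (e j) (a j - 1) \<noteq> 0" by blast
      have "box (aJ (insert j J)) \<noteq> box (aJ J)"
        using e box_pred_iff[OF j, of e "aJ J"] by (auto simp: aJ)
      then have dmJ: "dm (aJ J) = Suc (dm (aJ (insert j J)))"
        using dm_step_cases[OF j, of "aJ J"] by (simp add: aJ)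
      have dma: "dm (aJ J) \<le> dm a" by (rule dm_mono) (simp add: aJ_def)
      let ?Z = "card {w\<in>S J. coeff (w j) (a j - 1) = 0}"
      have "card (S J) = CARD('f) * ?Z" "card (S (insert j J)) = (CARD('f) - 1) * ?Z"
        using box_split[OF j insert.hyps(2), of e a "S J"] e box_aJ Sj by (auto simp: S_def)
      then have "CARD('f) * card (S (insert j J)) = (CARD('f) - 1) * card (S J)" by simp
      also have "\<dots> \<le> (CARD('f) - 1) * ((CARD('f) - 1) ^ (dm a - dm (aJ J)) * CARD('f) ^ dm (aJ J))"
        using IH by (rule mult_le_mono2)
      also have "\<dots> = CARD('f) * ((CARD('f) - 1) ^ (dm a - dm (aJ (insert j J))) *
          CARD('f) ^ dm (aJ (insert j J)))"
      proof -
        have "dm a - dm (aJ (insert j J)) = Suc (dm a - dm (aJ J))" using dma dmJ by simp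
        then show ?thesis by (simp add: dmJ)
      qed
      finally show ?thesis by simp
    next
      case False
      then have "box (aJ (insert j J)) = box (aJ J)"
        using box_pred_iff[OF j, of _ "aJ J"] by (auto simp: aJ)
      then have "dm (aJ (insert j J)) = dm (aJ J)" by (simp add: dm_def)
      moreover have "card (S (insert j J)) \<le> card (S J)"
        by (rule card_mono) (auto simp: S_def)
      ultimately show ?thesis using IH by simp
    qed
  qed
  from this[OF finite_u order_refl]
  have "card (S u) \<le> (CARD('f) - 1) ^ (dm a - dm (\<lambda>j. a j - 1)) * CARD('f) ^ dm (\<lambda>j. a j - 1)"
  proof -
    have "dm (aJ u) = dm (\<lambda>j. a j - 1)"
      unfolding dm_def using box_cong[of "aJ u" "\<lambda>j. a j - 1"] by (simp add: aJ_def)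
    then show ?thesis using \<open>card (S u) \<le> _\<close> by simp
  qed
  moreover have "{w\<in>L. \<forall>j\<in>u. len (w j) = a j} \<subseteq> S u"
  proof
    fix w assume w: "w \<in> {w\<in>L. \<forall>j\<in>u. len (w j) = a j}"
    then have "coeff (w j) (a j - 1) \<noteq> 0" if "j \<in> u" for j
      using len_eq_iff_coeff[of "w j" "a j"] assms that by auto
    then show "w \<in> S u" using w by (auto simp: S_def box_def)
  qed
  ultimately show ?thesis
    using card_mono[of "S u" "{w\<in>L. \<forall>j\<in>u. len (w j) = a j}"] by (simp add: S_def)
qed

end

section \<open>Tight boxes\<close>

definition lin :: "('f::field poly \<Rightarrow> 'f) \<Rightarrow> bool" where
  "lin \<phi> \<longleftrightarrow> (\<forall>g h. \<phi> (g + h) = \<phi> g + \<phi> h) \<and> (\<forall>c g. \<phi> (smult c g) = c * \<phi> g)"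

lemma lin_add: "lin \<phi> \<Longrightarrow> \<phi> (g + h) = \<phi> g + \<phi> h"
  and lin_smult: "lin \<phi> \<Longrightarrow> \<phi> (smult c g) = c * \<phi> g"
  by (simp_all add: lin_def)

lemma lin_0: "lin \<phi> \<Longrightarrow> \<phi> 0 = 0"
  using lin_smult[of \<phi> 0 0] by simp

lemma lin_diff: "lin \<phi> \<Longrightarrow> \<phi> (g - h) = \<phi> g - \<phi> h"
  using lin_add[of \<phi> "g - h" h] by simp

lemma lin_coeff: "lin (\<lambda>g. s * coeff g n + t * coeff g n')"
  by (simp add: lin_def algebra_simps)

context poly_lattice
begin

definition tight :: "(nat \<Rightarrow> nat) \<Rightarrow> bool" where
  "tight a \<longleftrightarrow> (\<forall>j\<in>u. 1 \<le> a j) \<and> (\<exists>k\<in>box a. full k) \<and>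
    (\<forall>w\<in>box a. full w \<longrightarrow> (\<forall>j\<in>u. coeff (w j) (a j - 1) \<noteq> 0))"

text \<open>Take the lengths of a full vector of least total length in the box. A full vector of the
  smaller box that missed one of these lengths would have smaller total length.\<close>

lemma exists_tight:
  assumes k: "k \<in> box a" "full k"
  obtains a0 where "tight a0" "\<And>j. j \<in> u \<Longrightarrow> a0 j \<le> a j"
proof -
  obtain h where h: "h \<in> box a" "full h"
    and min: "\<And>g. g \<in> box a \<Longrightarrow> full g \<Longrightarrow> (\<Sum>j\<in>u. len (h j)) \<le> (\<Sum>j\<in>u. len (g j))"
    using ex_has_least_nat[of "\<lambda>g. g \<in> box a \<and> full g" k "\<lambda>g. \<Sum>j\<in>u. len (g j)"] k by blast
  define a0 where "a0 j = len (h j)" for j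
  have le: "a0 j \<le> a j" if "j \<in> u" for j
    using box_len[OF h(1) that] by (simp add: a0_def)
  have "coeff (w j) (a0 j - 1) \<noteq> 0" if w: "w \<in> box a0" "full w" and j: "j \<in> u" for w j
  proof
    assume "coeff (w j) (a0 j - 1) = 0"
    then have "len (w j) \<le> len (h j) - 1"
      using len_le_pred_iff[OF box_len[OF w(1) j]] by (simp add: a0_def)
    then have "len (w j) < len (h j)"
      using h(2) j by (simp add: full_def) (metis Suc_pred len_pos_iff less_Suc_eq_le)
    then have "(\<Sum>j\<in>u. len (w j)) < (\<Sum>j\<in>u. len (h j))"
      using box_len[OF w(1)] j finite_u by (intro sum_strict_mono_ex1) (auto simp: a0_def)
    moreover have "w \<in> box a" using box_mono[of a0 a] le w(1) by blast
    ultimately show False using min[of w] w(2) by simp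
  qed
  moreover have "h \<in> box a0" using box_L[OF h(1)] by (simp add: box_def a0_def)
  moreover have "1 \<le> a0 j" if "j \<in> u" for j
    using h(2) that by (simp add: full_def a0_def Suc_le_eq)
  ultimately have "tight a0" using h(2) unfolding tight_def by blast
  then show ?thesis using le that by blast
qed

lemma tight_coeff:
  "tight a \<Longrightarrow> w \<in> box a \<Longrightarrow> full w \<Longrightarrow> j \<in> u \<Longrightarrow> coeff (w j) (a j - 1) \<noteq> 0"
  by (simp add: tight_def)

text \<open>The shift \<open>w = c x\<^sup>l v\<close> is chosen to cancel a leading coefficient of \<open>k\<close>, so no vector of
  \<open>k - w + box (a - 1)\<close> can be full.\<close>

lemma tight_cover:
  assumes a: "tight a" and k: "k \<in> box a" "full k"
    and v: "v \<in> box (\<lambda>j. a j - 1)" "v \<noteq> 0"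
  obtains w where "w \<in> box a" "w \<notin> box (\<lambda>j. a j - 1)" "\<And>i. v i = 0 \<Longrightarrow> w i = 0"
    "\<exists>l. \<forall>i. v i \<noteq> 0 \<longrightarrow> len (w i) = len (v i) + l"
    "\<And>z. z \<in> box (\<lambda>j. a j - 1) \<Longrightarrow> \<exists>i\<in>u. v i \<noteq> 0 \<and> k i - w i + z i = 0"
proof -
  define T where "T = {i\<in>u. v i \<noteq> 0}"
  have "T \<noteq> {}"
  proof
    assume "T = {}"
    then have "v i = 0" for i using off_u[OF box_L[OF v(1)], of i] by (auto simp: T_def)
    then show False using v(2) by auto
  qed
  have finT: "finite T" by (simp add: T_def finite_u)
  \<comment> \<open>\<open>j\<close> has the least slack \<open>a j - len (v j)\<close>.
    Multiplication by a monomial of that degree keeps all lengths within \<open>a\<close> and moves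
    the leading coefficient of \<open>v j\<close> to position \<open>a j - 1\<close>.\<close>
  then obtain j where j: "j \<in> T" and jmin: "\<And>i. i \<in> T \<Longrightarrow> a j - len (v j) \<le> a i - len (v i)"
    using ex_min_if_finite[of "(\<lambda>i. a i - len (v i)) ` T"] \<open>T \<noteq> {}\<close>
    by (auto simp: not_less)
  have ju: "j \<in> u" and vj: "v j \<noteq> 0" using j by (auto simp: T_def)
  define l where "l = a j - len (v j)"
  define c where "c = coeff (k j) (a j - 1) / coeff (v j) (a j - 1 - l)"
  define w where "w = (\<lambda>i. monom c l * v i)"
  have lv: "len (v i) \<le> a i - 1" if "i \<in> u" for i using box_len[OF v(1) that] .
  have a1: "1 \<le> a i" if "i \<in> u" for i using a that by (simp add: tight_def)
  have deg: "a j - 1 - l = degree (v j)"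
    using lv[OF ju] a1[OF ju] vj by (simp add: l_def len_def)
  have c0: "c \<noteq> 0"
    unfolding c_def deg using tight_coeff[OF a k ju] vj by simp
  have lj: "l \<le> a j - 1" using vj len_pos_iff[of "v j"] by (simp add: l_def del: len_pos_iff)
  have wj: "coeff (w j) (a j - 1) = coeff (k j) (a j - 1)"
    using lj vj unfolding w_def coeff_monom_mult c_def deg by simp
  have "len (w i) \<le> a i" if "i \<in> u" for i
  proof (cases "v i = 0")
    case False
    then have "l \<le> a i - len (v i)" using jmin[of i] that by (simp add: T_def l_def)
    then show ?thesis using lv[OF that] a1[OF that] False c0 by (simp add: w_def len_monom_mult)
  qed (simp add: w_def)
  then have w: "w \<in> box a" using scale_mem[OF box_L[OF v(1)], of "monom c l"] by (simp add: box_def w_def)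
  moreover have "w \<notin> box (\<lambda>j. a j - 1)"
    using wj tight_coeff[OF a k ju] ju unfolding box_pred_all_iff by metis
  moreover have "\<exists>l. \<forall>i. v i \<noteq> 0 \<longrightarrow> len (w i) = len (v i) + l"
    using c0 by (auto simp: w_def len_monom_mult)
  moreover have w0: "w i = 0" if "v i = 0" for i using that by (simp add: w_def)
  moreover have "\<exists>i\<in>u. v i \<noteq> 0 \<and> k i - w i + z i = 0" if z: "z \<in> box (\<lambda>j. a j - 1)" for z
  proof (rule ccontr)
    assume non: "\<not> ?thesis"
    have zc: "coeff (z i) (a i - 1) = 0" if "i \<in> u" for i
      using z that unfolding box_pred_all_iff by blast
    \<comment> \<open>Off the support of \<open>v\<close> the top coefficient is still that of
      \<open>k\<close>; on the support the assumption excludes a zero entry.\<close>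
    have "(k - w + z) i \<noteq> 0" if i: "i \<in> u" for i
    proof (cases "v i = 0")
      case True
      then have "coeff ((k - w + z) i) (a i - 1) = coeff (k i) (a i - 1)"
        using w0[OF True] zc[OF i] by simp
      then show ?thesis using tight_coeff[OF a k i] by (metis coeff_0)
    qed (use non i in auto)
    then have "full (k - w + z)" by (simp add: full_def)
    moreover have "k - w + z \<in> box a"
      using k(1) w z unfolding box_pred_all_iff by (blast intro: add_box diff_box)
    ultimately have "coeff ((k - w + z) j) (a j - 1) \<noteq> 0" using tight_coeff[OF a] ju by blast
    then show False using wj zc[OF ju] by simp
  qed
  ultimately show ?thesis using that by blast
qed

text \<open>Apply \<open>tight_cover\<close> to \<open>z = - f v\<close> for every \<open>f\<close>
  with \<open>len f \<le> l\<close>. This yields a coordinate in the support of \<open>v\<close>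
  with \<open>k i - w i = f * v i\<close>. Such a coordinate determines \<open>f\<close>, so the
  support is at least as large as the set of all \<open>f\<close>.\<close>

lemma tight_card_support:
  assumes a: "tight a" and v: "v \<in> box (\<lambda>j. a j - 1)" "v \<noteq> 0"
    and l: "\<And>i. i \<in> u \<Longrightarrow> v i \<noteq> 0 \<Longrightarrow> len (v i) + l \<le> a i"
  shows "CARD('f) ^ l \<le> card {i\<in>u. v i \<noteq> 0}"
proof -
  obtain k where k: "k \<in> box a" "full k" using a unfolding tight_def by blast
  obtain w where w: "\<And>z. z \<in> box (\<lambda>j. a j - 1) \<Longrightarrow> \<exists>i\<in>u. v i \<noteq> 0 \<and> k i - w i + z i = 0"
    by (rule tight_cover[OF a k v]) blast
  have "\<exists>i\<in>u. v i \<noteq> 0 \<and> k i - w i = f * v i" if f: "len f \<le> l" for f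
  proof -
    have "(\<lambda>i. - f * v i) \<in> box (\<lambda>j. a j - 1)"
    proof -
      have "len (- f * v i) \<le> a i - 1" if "i \<in> u" for i
      proof (cases "f = 0 \<or> v i = 0")
        case False
        then have "len (- f * v i) = len f + len (v i) - 1"
          using len_mult[of "- f" "v i"] by (simp add: len_def)
        then show ?thesis using l[OF that] False f by simp
      qed auto
      then show ?thesis using scale_mem[OF box_L[OF v(1)], of "- f"] by (simp add: box_def)
    qed
    from w[OF this] show ?thesis by auto
  qed
  then obtain i where i: "\<And>f. len f \<le> l \<Longrightarrow> i f \<in> u \<and> v (i f) \<noteq> 0 \<and> k (i f) - w (i f) = f * v (i f)"
    by metis
  have "inj_on i {f. len f \<le> l}"
  proof (rule inj_onI)
    fix f g assume fg: "f \<in> {f. len f \<le> l}" "g \<in> {f. len f \<le> l}" "i f = i g"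
    then have "f * v (i f) = g * v (i f)" using i[of f] i[of g] by (metis mem_Collect_eq)
    then show "f = g" using i[of f] fg(1) by simp
  qed
  then have "card {f :: 'f poly. len f \<le> l} \<le> card {i\<in>u. v i \<noteq> 0}"
    by (rule card_inj_on_le) (use i finite_u in auto)
  then show ?thesis using card_len_le[where ?'f = 'f and a = l] by simp
qed

text \<open>With full support, \<open>v\<close> would be a full vector of the tight box that attains
  none of the lengths.\<close>

lemma tight_support_card_less:
  assumes a: "tight a" and "u \<noteq> {}" and v: "v \<in> box (\<lambda>j. a j - 1)"
  shows "card {i\<in>u. v i \<noteq> 0} < card u"
proof -
  obtain j where "j \<in> u" using assms(2) by blast
  then have "\<not> full v" using v tight_coeff[OF a, of v j] unfolding box_pred_all_iff by blast
  then show ?thesis by (intro psubset_card_mono finite_u) (auto simp: full_def)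
qed

text \<open>Among all choices of functionals \<open>\<phi> i\<close> with \<open>\<phi> i (k i) \<noteq> 0\<close> take one whose common kernel on
  \<open>box (a - 1)\<close> is smallest. If that kernel contained some \<open>v \<noteq> 0\<close>, minimality would yield vectors dual
  to the \<open>\<phi> i\<close> on the support of \<open>v\<close>, and adding those to \<open>k - w\<close> contradicts \<open>tight_cover\<close>.
  A vector of \<open>box a\<close> in the common kernel lies in \<open>box (a - 1)\<close>, because all of \<open>k + c w\<close> are full.\<close>

lemma tight_dm_le:
  assumes a: "tight a"
  shows "dm a \<le> card u"
proof -
  let ?V = "box (\<lambda>j. a j - 1)"
  obtain k where k: "k \<in> box a" "full k" using a unfolding tight_def by blast
  define adm where "adm \<phi> \<longleftrightarrow> (\<forall>i\<in>u. lin (\<phi> i) \<and> \<phi> i (k i) \<noteq> 0)" for \<phi>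
  define X where "X \<phi> = {v\<in>?V. \<forall>i\<in>u. \<phi> i (v i) = 0}" for \<phi> :: "nat \<Rightarrow> 'f poly \<Rightarrow> 'f"
  have finX: "finite (X \<phi>)" for \<phi> by (simp add: X_def)
  have "adm (\<lambda>i g. coeff g (a i - 1))"
    using tight_coeff[OF a k] by (simp add: adm_def lin_def)
  then obtain \<phi> where \<phi>: "adm \<phi>" and min: "\<And>\<phi>'. adm \<phi>' \<Longrightarrow> card (X \<phi>) \<le> card (X \<phi>')"
    using ex_has_least_nat[of adm _ "\<lambda>\<phi>. card (X \<phi>)"] by blast
  have \<phi>lin: "lin (\<phi> i)" and \<phi>k: "\<phi> i (k i) \<noteq> 0" if "i \<in> u" for i
    using \<phi> that by (auto simp: adm_def)
  have X0: "v = 0" if vX: "v \<in> X \<phi>" for v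
  proof (rule ccontr)
    assume v0: "v \<noteq> 0"
    have v: "v \<in> ?V" using vX by (simp add: X_def)
    have dual: "\<exists>e\<in>?V. \<phi> i (e i) \<noteq> 0 \<and> (\<forall>j\<in>u - {i}. \<phi> j (e j) = 0)" if i: "i \<in> u" "v i \<noteq> 0" for i
    proof -
      define d where "d = degree (v i)"
      have lv: "len (v i) \<le> a i - 1" using box_len[OF v i(1)] .
      \<comment> \<open>\<open>\<psi>\<close> reads the coefficient at the degree of
        \<open>v i\<close>; the top coefficient is added exactly when \<open>\<psi> (k i)\<close>
        would otherwise be 0.\<close>
      define s where "s = (if coeff (k i) d = 0 then 1 else 0 :: 'f)"
      define \<psi> where "\<psi> g = s * coeff g (a i - 1) + 1 * coeff g d" for g
      have "coeff (v i) (a i - 1) = 0" using lv by (simp add: coeff_len_eq_0)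
      then have \<psi>v: "\<psi> (v i) \<noteq> 0" using i(2) by (simp add: \<psi>_def d_def)
      have \<psi>k: "\<psi> (k i) \<noteq> 0" using tight_coeff[OF a k i(1)] by (simp add: \<psi>_def s_def)
      have "lin \<psi>" unfolding \<psi>_def by (rule lin_coeff)
      then have "adm (\<phi>(i := \<psi>))" using \<phi> \<psi>k by (simp add: adm_def)
      then have "card (X \<phi>) \<le> card (X (\<phi>(i := \<psi>)))" by (rule min)
      \<comment> \<open>Imposing \<open>\<psi>\<close> on \<open>X \<phi>\<close> in addition
        excludes \<open>v\<close>, whereas putting \<open>\<psi>\<close> in place of
        \<open>\<phi> i\<close> gives a kernel at least as large as \<open>X \<phi>\<close>. So the
        latter contains a vector \<open>e\<close> on which, among the \<open>\<phi> j\<close>, only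
        \<open>\<phi> i\<close> is nonzero.\<close>
      moreover have "card {x\<in>X \<phi>. \<psi> (x i) = 0} < card (X \<phi>)"
        by (rule psubset_card_mono) (use vX \<psi>v in \<open>auto simp: X_def\<close>)
      ultimately have "\<not> X (\<phi>(i := \<psi>)) \<subseteq> {x\<in>X \<phi>. \<psi> (x i) = 0}"
        using card_mono[of "{x\<in>X \<phi>. \<psi> (x i) = 0}" "X (\<phi>(i := \<psi>))"] finX by fastforce
      then obtain e where e: "e \<in> X (\<phi>(i := \<psi>))" "\<not> (e \<in> X \<phi> \<and> \<psi> (e i) = 0)" by blast
      have ej: "\<phi> j (e j) = 0" if "j \<in> u - {i}" for j
        using e(1) that by (auto simp: X_def split: if_splits)
      have "\<psi> (e i) = 0" "e \<in> ?V" using e(1) i(1) by (auto simp: X_def)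
      moreover have "\<phi> i (e i) \<noteq> 0"
      proof
        assume "\<phi> i (e i) = 0"
        then have "\<forall>j\<in>u. \<phi> j (e j) = 0" using ej by blast
        then show False using e(2) \<open>\<psi> (e i) = 0\<close> \<open>e \<in> ?V\<close> by (simp add: X_def)
      qed
      ultimately show ?thesis using ej by blast
    qed
    obtain w where w: "\<And>z. z \<in> ?V \<Longrightarrow> \<exists>i\<in>u. v i \<noteq> 0 \<and> k i - w i + z i = 0"
      by (rule tight_cover[OF a k v v0]) blast
    \<comment> \<open>The coordinates in the support of \<open>v\<close> are repaired one by one:
      adding the vector dual to \<open>\<phi> i\<close> changes no other \<open>\<phi> j\<close>, so
      values already made nonzero stay nonzero.\<close>
    have "\<exists>z\<in>?V. \<forall>i\<in>J. \<phi> i (k i - w i + z i) \<noteq> 0"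
      if "finite J" "J \<subseteq> {i\<in>u. v i \<noteq> 0}" for J
      using that
    proof (induction J rule: finite_induct)
      case empty
      then show ?case using zero_box by blast
    next
      case (insert i J)
      then obtain z where z: "z \<in> ?V" "\<forall>j\<in>J. \<phi> j (k j - w j + z j) \<noteq> 0" by auto
      show ?case
      proof (cases "\<phi> i (k i - w i + z i) = 0")
        case False
        then show ?thesis using z by auto
      next
        case True
        obtain e where e: "e \<in> ?V" "\<phi> i (e i) \<noteq> 0" "\<forall>j\<in>u - {i}. \<phi> j (e j) = 0"
          using dual[of i] insert.prems by auto
        have add: "\<phi> j (k j - w j + (z + e) j) = \<phi> j (k j - w j + z j) + \<phi> j (e j)"
          if "j \<in> insert i J" for j
          using lin_add[OF \<phi>lin[of j], of "k j - w j + z j" "e j"] that insert.prems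
          by (auto simp: add.assoc)
        have "\<forall>j\<in>insert i J. \<phi> j (k j - w j + (z + e) j) \<noteq> 0"
        proof (intro ballI)
          fix j assume "j \<in> insert i J"
          moreover have "j \<in> u - {i}" if "j \<in> J" using that insert.prems insert.hyps(2) by auto
          ultimately show "\<phi> j (k j - w j + (z + e) j) \<noteq> 0"
            using e z(2) True add by (metis add_cancel_left_left add_cancel_right_right insert_iff)
        qed
        then show ?thesis using add_box[OF z(1) e(1)] by blast
      qed
    qed
    from this[of "{i\<in>u. v i \<noteq> 0}"] obtain z
      where z: "z \<in> ?V" "\<forall>i\<in>{i\<in>u. v i \<noteq> 0}. \<phi> i (k i - w i + z i) \<noteq> 0"
      using finite_u by auto
    from w[OF z(1)] obtain i where "i \<in> u" "v i \<noteq> 0" "k i - w i + z i = 0" by blast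
    then show False using z(2) lin_0[OF \<phi>lin[of i]] by auto
  qed
  have ker: "w = 0" if w: "w \<in> box a" "\<forall>i\<in>u. \<phi> i (w i) = 0" for w
  proof -
    have "coeff (w i) (a i - 1) = 0" if i: "i \<in> u" for i
    proof (rule ccontr)
      assume ne: "coeff (w i) (a i - 1) \<noteq> 0"
      define c where "c = - coeff (k i) (a i - 1) / coeff (w i) (a i - 1)"
      define h where "h = k + (\<lambda>j. smult c (w j))"
      have "h \<in> box a" unfolding h_def by (intro add_box smult_box k w)
      moreover have "full h" unfolding full_def
      proof
        fix j assume j: "j \<in> u"
        have "\<phi> j (h j) = \<phi> j (k j)"
          using w(2) j by (simp add: h_def lin_add[OF \<phi>lin] lin_smult[OF \<phi>lin])
        then show "h j \<noteq> 0" using \<phi>k[OF j] lin_0[OF \<phi>lin[OF j]] by auto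
      qed
      ultimately have "coeff (h i) (a i - 1) \<noteq> 0" using tight_coeff[OF a] i by blast
      then show False using ne by (simp add: h_def c_def)
    qed
    then have "w \<in> X \<phi>" using w unfolding X_def box_pred_all_iff by blast
    then show ?thesis by (rule X0)
  qed
  define \<Phi> where "\<Phi> w = restrict (\<lambda>i. \<phi> i (w i)) u" for w
  have "inj_on \<Phi> (box a)"
  proof (rule inj_onI)
    fix g h assume g: "g \<in> box a" and h: "h \<in> box a" and eq: "\<Phi> g = \<Phi> h"
    have "\<phi> i ((g - h) i) = 0" if "i \<in> u" for i
      using fun_cong[OF eq, of i] that by (simp add: \<Phi>_def lin_diff[OF \<phi>lin])
    then have "g - h = 0" by (intro ker diff_box g h) blast
    then show "g = h" by simp
  qed
  then have "card (box a) \<le> card (PiE u (\<lambda>_. UNIV :: 'f set))"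
    by (rule card_inj_on_le) (auto simp: \<Phi>_def intro: finite_PiE finite_u)
  then show ?thesis by (simp add: card_PiE finite_u dm_le_iff)
qed

text \<open>Nonzero vectors of the box \<open>a - 1\<close> have at least \<open>CARD('f)\<close>
  and fewer than \<open>card u\<close> nonzero entries. The next two bounds exhibit independent
  families in \<open>box a\<close>, whose dimension is at most \<open>card u\<close> by
  \<open>tight_dm_le\<close>; the last one compares with a trivial box.\<close>

lemma tight_rank:
  assumes a: "tight a" and u: "u \<noteq> {}" and r: "0 < dm (\<lambda>j. a j - 1)"
  shows "CARD('f) < card u" and "dm (\<lambda>j. a j - 1) + 2 \<le> card u"
    and "card u \<le> 4 \<Longrightarrow> dm (\<lambda>j. a j - 1) \<le> 1"
    and "dm (\<lambda>j. a j - 1) + 1 + card u \<le> (\<Sum>j\<in>u. a j)"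
proof -
  let ?V = "box (\<lambda>j. a j - 1)" and ?r = "dm (\<lambda>j. a j - 1)"
  have b2: "2 \<le> CARD('f)" by (rule CARD_field_ge_2)
  have a1: "1 \<le> a i" if "i \<in> u" for i using a that by (simp add: tight_def)
  have Va: "z \<in> box a" if "z \<in> ?V" for z using that unfolding box_pred_all_iff by blast
  have Vc: "coeff (z i) (a i - 1) = 0" if "z \<in> ?V" "i \<in> u" for z i
    using that unfolding box_pred_all_iff by blast
  have Vlen: "len (z i) + 1 \<le> a i" if "z \<in> ?V" "i \<in> u" for z i
    using box_len[OF that] a1[OF that(2)] by simp
  have supp: "CARD('f) \<le> card {i\<in>u. z i \<noteq> 0}" if "z \<in> ?V" "z \<noteq> 0" for z
    using tight_card_support[OF a that, of 1] Vlen[OF that(1)] by simp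
  have "?V \<noteq> {0}"
  proof
    assume "?V = {0}"
    then have "CARD('f) ^ ?r = 1" by (simp add: card_box[symmetric])
    then show False using r b2 by simp
  qed
  then obtain v where v: "v \<in> ?V" "v \<noteq> 0" using zero_box by blast
  note less = tight_support_card_less[OF a u]
  show bn: "CARD('f) < card u" using supp[OF v] less[OF v(1)] by simp
  obtain k where k: "k \<in> box a" "full k" using a unfolding tight_def by blast
  obtain w where w: "w \<in> box a" "w \<notin> ?V" "\<And>i. v i = 0 \<Longrightarrow> w i = 0"
    by (rule tight_cover[OF a k v]) blast
  obtain i0 where i0: "i0 \<in> u" "v i0 = 0"
  proof -
    have "{i\<in>u. v i \<noteq> 0} \<noteq> u" using less[OF v(1)] by auto
    then show ?thesis using that by blast
  qed
  \<comment> \<open>\<open>k\<close>, \<open>w\<close> and \<open>?V\<close> are independent: at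
    \<open>i0\<close>, where \<open>w\<close> vanishes, the top coefficient determines the multiple
    of \<open>k\<close>; the multiple of \<open>w\<close> is then determined because
    \<open>w\<close> is not in \<open>?V\<close>.\<close>
  have inj1: "inj_on (\<lambda>(c, c', z). (\<lambda>i. smult c (k i)) + (\<lambda>i. smult c' (w i)) + z) (UNIV \<times> UNIV \<times> ?V)"
    (is "inj_on ?f ?D")
  proof (rule inj_onI)
    fix p q assume pq: "p \<in> ?D" "q \<in> ?D" "?f p = ?f q"
    obtain c c' z d d' y where p: "p = (c, c', z)" and q: "q = (d, d', y)"
      by (cases p, cases q) auto
    have z: "z \<in> ?V" and y: "y \<in> ?V" using pq by (auto simp: p q)
    have eq: "(\<lambda>i. smult c (k i)) + (\<lambda>i. smult c' (w i)) + z =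
        (\<lambda>i. smult d (k i)) + (\<lambda>i. smult d' (w i)) + y"
      using pq(3) unfolding p q by simp
    have eqi: "smult c (k i) + smult c' (w i) + z i = smult d (k i) + smult d' (w i) + y i" for i
      using fun_cong[OF eq, of i] by simp
    have "c * coeff (k i0) (a i0 - 1) = d * coeff (k i0) (a i0 - 1)"
      using arg_cong[OF eqi[of i0], of "\<lambda>p. coeff p (a i0 - 1)"] w(3)[OF i0(2)]
        Vc[OF z i0(1)] Vc[OF y i0(1)] by simp
    then have cd: "c = d" using tight_coeff[OF a k i0(1)] by simp
    have cd': "c' = d'"
    proof (rule ccontr)
      assume ne: "c' \<noteq> d'"
      have "coeff (w i) (a i - 1) = 0" if i: "i \<in> u" for i
      proof -
        have "c' * coeff (w i) (a i - 1) = d' * coeff (w i) (a i - 1)"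
          using arg_cong[OF eqi[of i], of "\<lambda>p. coeff p (a i - 1)"] Vc[OF z i] Vc[OF y i] cd by simp
        then show ?thesis using ne by simp
      qed
      then show False using w(1,2) unfolding box_pred_all_iff by blast
    qed
    show "p = q" using cd cd' eq by (simp add: p q)
  qed
  have "card ((UNIV :: 'f set) \<times> (UNIV :: 'f set) \<times> ?V) \<le> card (box a)"
    by (rule card_inj_on_le[OF inj1]) (auto intro!: add_box smult_box k w dest: Va[unfolded One_nat_def])
  then have "CARD('f) ^ (?r + 2) \<le> CARD('f) ^ dm a"
    by (simp add: card_cartesian_product card_box power_add power2_eq_square mult_ac)
  then have "?r + 2 \<le> dm a" using b2 by (subst (asm) power_increasing_iff) auto
  then show "?r + 2 \<le> card u" using tight_dm_le[OF a] by linarith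
  show "?r \<le> 1" if n4: "card u \<le> 4"
  proof -
    \<comment> \<open>\<open>?V\<close>, its shift by x and \<open>k\<close> are independent. In a
      relation \<open>x h + c k \<in> ?V\<close> with \<open>h \<in> ?V\<close>, a nonzero
      \<open>c\<close> would make \<open>h\<close> full. If \<open>c = 0\<close> and
      \<open>h \<noteq> 0\<close>, then \<open>h\<close> has room for two more degrees, so its
      support has at least \<open>CARD('f) ^ 2 \<ge> 4\<close> elements. Both contradict the support
      being smaller than \<open>card u\<close>.\<close>
    have inj2: "inj_on (\<lambda>(z, z', c). z + (\<lambda>i. monom 1 1 * z' i) + (\<lambda>i. smult c (k i))) (?V \<times> ?V \<times> UNIV)"
      (is "inj_on ?f ?D")
    proof (rule inj_onI)
      fix p q assume pq: "p \<in> ?D" "q \<in> ?D" "?f p = ?f q"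
      obtain z z' c y y' d where p: "p = (z, z', c)" and q: "q = (y, y', d)"
        by (cases p, cases q) auto
      have z: "z \<in> ?V" "z' \<in> ?V" and y: "y \<in> ?V" "y' \<in> ?V" using pq by (auto simp: p q)
      have eq: "z + (\<lambda>i. monom 1 1 * z' i) + (\<lambda>i. smult c (k i)) =
          y + (\<lambda>i. monom 1 1 * y' i) + (\<lambda>i. smult d (k i))"
        using pq(3) unfolding p q by simp
      define h where "h = z' - y'"
      have h: "h \<in> ?V" unfolding h_def by (intro diff_box z y)
      have eqi: "monom 1 1 * h i + smult (c - d) (k i) = (y - z) i" for i
      proof -
        have "z i + monom 1 1 * z' i + smult c (k i) = y i + monom 1 1 * y' i + smult d (k i)"
          using fun_cong[OF eq, of i] by simp
        then have y: "y i = z i + monom 1 1 * z' i + smult c (k i) - monom 1 1 * y' i - smult d (k i)"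
          by (simp add: eq_diff_eq)
        show ?thesis by (simp add: y h_def right_diff_distrib smult_diff_left)
      qed
      have yz: "y - z \<in> ?V" by (intro diff_box z y)
      have cd: "c = d"
      proof (rule ccontr)
        assume ne: "c \<noteq> d"
        have "h i \<noteq> 0" if i: "i \<in> u" for i
        proof
          assume "h i = 0"
          then have "(c - d) * coeff (k i) (a i - 1) = 0"
            using arg_cong[OF eqi[of i], of "\<lambda>p. coeff p (a i - 1)"] Vc[OF yz i] by simp
          then show False using ne tight_coeff[OF a k i] by simp
        qed
        then have "{i\<in>u. h i \<noteq> 0} = u" by blast
        then show False using less[OF h] by simp
      qed
      have "h = 0"
      proof (rule ccontr)
        assume h0: "h \<noteq> 0"
        have "len (h i) + 2 \<le> a i" if "i \<in> u" "h i \<noteq> 0" for i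
        proof -
          have "len (h i) + 1 = len ((y - z) i)"
            using eqi[of i] cd that(2) len_monom_mult[of "1 :: 'f" "h i" 1] by simp
          then show ?thesis using Vlen[OF yz that(1)] by simp
        qed
        then have "CARD('f) ^ 2 \<le> card {i\<in>u. h i \<noteq> 0}"
          by (intro tight_card_support[OF a h h0])
        moreover have "2 ^ 2 \<le> CARD('f) ^ 2" by (rule power_mono[OF b2]) simp
        ultimately show False using less[OF h] n4 by simp
      qed
      then show "p = q" using eq cd by (simp add: h_def p q)
    qed
    have sh: "(\<lambda>i. monom 1 1 * z i) \<in> box a" if "z \<in> ?V" for z
    proof -
      have "len (monom 1 1 * z i) \<le> a i" if i: "i \<in> u" for i
        using Vlen[OF \<open>z \<in> ?V\<close> i] len_monom_mult[of "1 :: 'f" "z i" 1] by (cases "z i = 0") auto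
      then show ?thesis using scale_mem[OF box_L[OF that], of "monom 1 1"] by (simp add: box_def)
    qed
    have "card (?V \<times> ?V \<times> (UNIV :: 'f set)) \<le> card (box a)"
      by (rule card_inj_on_le[OF inj2]) (auto intro!: add_box smult_box k sh[unfolded One_nat_def] dest: Va[unfolded One_nat_def])
    then have "CARD('f) ^ (?r + ?r + 1) \<le> CARD('f) ^ dm a"
      by (simp add: card_cartesian_product card_box power_add mult_ac)
    then have "?r + ?r + 1 \<le> dm a" using b2 by (subst (asm) power_increasing_iff) auto
    then show ?thesis using tight_dm_le[OF a] n4 by simp
  qed
  show "?r + 1 + card u \<le> (\<Sum>j\<in>u. a j)"
  proof -
    have "\<exists>j\<in>u. v j \<noteq> 0"
    proof (rule ccontr)
      assume "\<not> ?thesis"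
      then have "v = 0" using off_u[OF box_L[OF v(1)]] by (intro ext) auto
      then show False using v(2) by simp
    qed
    then obtain j where j: "j \<in> u" "v j \<noteq> 0" by blast
    \<comment> \<open>The box with room in coordinate \<open>j\<close> alone is trivial, because
      nonzero vectors of \<open>?V\<close> have at least two nonzero entries. Enlarging it to
      \<open>?V\<close> adds at most the sum of \<open>a i - 1\<close> over
      \<open>i \<noteq> j\<close>, and \<open>a j \<ge> 2\<close>.\<close>
    define a' where "a' = (\<lambda>i. if i = j then a j - 1 else 0)"
    have "g = 0" if g: "g \<in> box a'" for g
    proof (rule ccontr)
      assume "g \<noteq> 0"
      moreover have "box a' \<subseteq> ?V" by (rule box_mono) (simp add: a'_def)
      then have "g \<in> ?V" using g by blast
      ultimately have "CARD('f) \<le> card {i\<in>u. g i \<noteq> 0}" by (rule supp[rotated])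
      moreover have "{i\<in>u. g i \<noteq> 0} \<subseteq> {j}"
      proof
        fix i assume i: "i \<in> {i\<in>u. g i \<noteq> 0}"
        then have "len (g i) \<le> a' i" using box_len[OF g] by blast
        then show "i \<in> {j}" using i by (auto simp: a'_def split: if_splits)
      qed
      ultimately show False using card_mono[of "{j}" "{i\<in>u. g i \<noteq> 0}"] b2 by simp
    qed
    then have "box a' = {0}" using zero_box by blast
    then have "dm a' = 0" using dm_eq_iff[of a' 0] by simp
    moreover have "?r \<le> dm a' + (\<Sum>i\<in>u. a i - 1 - a' i)"
      by (rule dm_le_add) (simp add: a'_def)
    moreover have "(\<Sum>i\<in>u. a i) = a j + (\<Sum>i\<in>u - {j}. a i)"
      "(\<Sum>i\<in>u. a i - 1 - a' i) = (\<Sum>i\<in>u - {j}. a i - 1 - a' i)"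
      using j finite_u by (simp_all add: sum.remove a'_def)
    moreover have "(\<Sum>i\<in>u - {j}. a i) = (\<Sum>i\<in>u - {j}. (a i - 1 - a' i) + 1)"
    proof (rule sum.cong)
      fix i assume "i \<in> u - {j}"
      then show "a i = (a i - 1 - a' i) + 1" using a1[of i] by (simp add: a'_def)
    qed simp
    moreover have "\<dots> = (\<Sum>i\<in>u - {j}. a i - 1 - a' i) + (card u - 1)"
      using j finite_u by (simp only: sum.distrib sum_constant card_Diff_singleton mult_1_right)
        simp
    moreover have "0 < card u" using j finite_u card_gt_0_iff by blast
    moreover have "2 \<le> a j" using Vlen[OF v(1) j(1)] j(2) len_pos_iff[of "v j"] by linarith
    ultimately show ?thesis by linarith
  qed
qed

end

section \<open>Counting vectors by weight\<close>

definition comps :: "nat set \<Rightarrow> nat \<Rightarrow> (nat \<Rightarrow> nat) set" where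
  "comps u N = {a. (\<forall>j\<in>u. 1 \<le> a j) \<and> (\<forall>j. j \<notin> u \<longrightarrow> a j = 0) \<and> (\<Sum>j\<in>u. a j) = N}"

text \<open>Subtracting 1 from every part leaves lists of length \<open>card u\<close> with sum
  \<open>N - card u\<close>, which are counted by stars and bars.\<close>

lemma card_comps_le:
  assumes "finite u" "u \<noteq> {}"
  shows "finite (comps u N)" and "card (comps u N) \<le> (N - 1) choose (card u - 1)"
proof -
  define C where "C = comps u N"
  note C_def = C_def comps_def
  define f where "f a = map (\<lambda>j. a j - 1) (sorted_list_of_set u)" for a :: "nat \<Rightarrow> nat"
  have n: "0 < card u" using assms(1,2) by (simp add: card_gt_0_iff)
  have inj: "inj_on f C"
  proof (rule inj_onI, rule ext)
    fix a a' j assume a: "a \<in> C" "a' \<in> C" and eq: "f a = f a'"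
    show "a j = a' j"
    proof (cases "j \<in> u")
      case True
      then have "a j - 1 = a' j - 1" using eq assms(1) by (simp add: f_def)
      moreover have "1 \<le> a j" "1 \<le> a' j" using a True by (auto simp: C_def)
      ultimately show ?thesis by simp
    qed (use a in \<open>auto simp: C_def\<close>)
  qed
  have im: "length (f a) = card u \<and> sum_list (f a) = N - card u" and le: "card u \<le> N"
    if a: "a \<in> C" for a
  proof -
    have "(\<Sum>j\<in>u. a j) = (\<Sum>j\<in>u. (a j - 1) + 1)"
      by (rule sum.cong) (use a in \<open>auto simp: C_def\<close>)
    also have "\<dots> = (\<Sum>j\<in>u. a j - 1) + card u" by (simp only: sum.distrib sum_constant) simp
    finally have "N = (\<Sum>j\<in>u. a j - 1) + card u" using a by (simp add: C_def)
    moreover have "sum_list (f a) = (\<Sum>j\<in>u. a j - 1)"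
      using assms(1) by (simp add: f_def sum_list_distinct_conv_sum_set)
    ultimately show "length (f a) = card u \<and> sum_list (f a) = N - card u" "card u \<le> N"
      by (simp_all add: f_def)
  qed
  have fin: "finite {l :: nat list. length l = k \<and> sum_list l = s}" for k s
    by (rule finite_subset[OF _ finite_lists_length_eq[of "{..s}" k]])
      (auto dest: member_le_sum_list)
  show "finite (comps u N)" unfolding C_def(1)[symmetric]
    by (rule finite_imageD[OF finite_subset[OF _ fin[of "card u" "N - card u"]] inj]) (use im in auto)
  have "card C \<le> (N - 1) choose (card u - 1)"
  proof (cases "C = {}")
    case False
    then have N: "card u \<le> N" using le by blast
    have "card C \<le> card {l :: nat list. length l = card u \<and> sum_list l = N - card u}"
      by (rule card_inj_on_le[OF inj _ fin]) (use im in auto)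
    also have "\<dots> = (N - card u + card u - 1) choose (N - card u)" by (rule card_length_sum_list)
    also have "\<dots> = (N - 1) choose (N - card u)" using N by simp
    also have "\<dots> = (N - 1) choose (card u - 1)"
      using N n by (subst binomial_symmetric) auto
    finally show ?thesis .
  qed simp
  then show "card (comps u N) \<le> (N - 1) choose (card u - 1)" by (simp add: C_def(1))
qed

section \<open>The number of cells compared with powers of \<open>m + 1\<close>\<close>

lemma binomial_add_eq_prod:
  "real ((d + \<tau> + t) choose t) = real ((\<tau> + t) choose t) * (\<Prod>i=1..t. 1 + real d / real (\<tau> + i))"
proof (induction t)
  case (Suc t)
  have step: "real ((s + Suc t) choose Suc t) = real ((s + t) choose t) * (real (s + Suc t) / real (Suc t))" for s
  proof -
    have "Suc t * ((s + Suc t) choose Suc t) = (s + Suc t) * ((s + t) choose t)"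
      using Suc_times_binomial[of t "s + t"] by simp
    then have "real (Suc t) * real ((s + Suc t) choose Suc t) = real (s + Suc t) * real ((s + t) choose t)"
      by (metis of_nat_mult)
    then show ?thesis by (simp add: field_simps)
  qed
  have fac: "real (d + \<tau> + Suc t) = real (\<tau> + Suc t) * (1 + real d / real (\<tau> + Suc t))"
    by (simp add: field_simps)
  have prodS: "(\<Prod>i=1..Suc t. 1 + real d / real (\<tau> + i)) =
      (\<Prod>i=1..t. 1 + real d / real (\<tau> + i)) * (1 + real d / real (\<tau> + Suc t))"
    by simp
  show ?case unfolding step Suc.IH fac prodS
    by (simp only: mult_ac times_divide_eq_left times_divide_eq_right)
qed simp

text \<open>For \<open>d > 0\<close> every factor with \<open>i \<ge> 2\<close> is smaller than
  \<open>1 + d\<close>, and this slack pays for \<open>2 ^ E\<close>. When \<open>t\<close> grows by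
  one, \<open>E\<close> may grow to \<open>t\<close> only if \<open>d \<ge> t + 1\<close>, and then
  the new factor pays for one more 2.\<close>

lemma prod_one_plus_le:
  assumes "E = 0 \<or> E + 1 \<le> t \<and> E + 1 \<le> d" and "4 \<le> t"
  shows "2 ^ E * (\<Prod>i=1..t. 1 + real d / real i) \<le> (1 + real d) ^ t"
  using assms(2,1)
proof (induction t arbitrary: E rule: dec_induct)
  case base
  have pr: "(\<Prod>i=1..4::nat. 1 + real d / real i) =
      (1 + real d) * ((2 + real d) * (3 + real d) * (4 + real d) / 24)"
    by (simp add: numeral_eq_Suc prod.atLeast1_atMost_eq field_simps)
  have "2 ^ E * ((2 + real d) * (3 + real d) * (4 + real d)) \<le> 24 * (1 + real d) ^ 3"
  proof -
    have cases: "E = 0 \<or> E = 1 \<and> 2 \<le> d \<or> E = 2 \<and> 3 \<le> d \<or> E = 3 \<and> 4 \<le> d"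
      using base by auto
    \<comment> \<open>Written in \<open>e\<close>, with \<open>c\<close> the least admissible
      \<open>d\<close>, each inequality holds coefficient by coefficient.\<close>
    have "\<exists>e. d = c + e" if "c \<le> d" for c using that le_Suc_ex by blast
    then consider "E = 0" | e where "E = 1" "d = 2 + e" | e where "E = 2" "d = 3 + e"
      | e where "E = 3" "d = 4 + e"
      using cases by metis
    then show ?thesis
      by cases (simp_all add: power3_eq_cube algebra_simps)
  qed
  then have "2 ^ E * ((2 + real d) * (3 + real d) * (4 + real d) / 24) \<le> (1 + real d) ^ 3" by simp
  then have "(1 + real d) * (2 ^ E * ((2 + real d) * (3 + real d) * (4 + real d) / 24)) \<le>
      (1 + real d) * (1 + real d) ^ 3"
    by (rule mult_left_mono) simp
  moreover have "(1 + real d) ^ 4 = (1 + real d) * (1 + real d) ^ 3" by (simp add: numeral_eq_Suc)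
  ultimately show ?case unfolding pr by (simp only: mult.left_commute)
next
  case (step t)
  let ?P = "\<Prod>i=1..t. 1 + real d / real i" and ?f = "1 + real d / real (Suc t)"
  have P0: "0 \<le> ?P" by (rule prod_nonneg) simp
  show ?case
  proof (cases "E = t")
    case False
    have "2 ^ E * ?P \<le> (1 + real d) ^ t" using step.IH[of E] step.prems False by auto
    moreover have "?f \<le> 1 + real d" by (simp add: field_simps)
    ultimately have "(2 ^ E * ?P) * ?f \<le> (1 + real d) ^ t * (1 + real d)"
      by (intro mult_mono) auto
    then show ?thesis by (simp add: mult_ac)
  next
    case True
    then obtain E' where E': "E = Suc E'" using step.hyps by (cases E) auto
    have d: "t + 1 \<le> d" using step.prems True step.hyps by auto
    have "2 ^ E' * ?P \<le> (1 + real d) ^ t" using step.IH[of E'] step.prems E' by auto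
    moreover have "2 * ?f \<le> 1 + real d"
    proof -
      have "real d / real (Suc t) \<le> real d / 5" using step.hyps by (intro divide_left_mono) auto
      moreover have "5 \<le> real d" using d step.hyps by simp
      ultimately show ?thesis by simp
    qed
    ultimately have "(2 ^ E' * ?P) * (2 * ?f) \<le> (1 + real d) ^ t * (1 + real d)"
      using P0 by (intro mult_mono) auto
    moreover have "(\<Prod>i=1..Suc t. 1 + real d / real i) = ?P * ?f" by simp
    moreover have "2 ^ E * (?P * ?f) = (2 ^ E' * ?P) * (2 * ?f)"
      by (simp only: E' power_Suc mult_ac)
    ultimately show ?thesis by (simp only: power_Suc2)
  qed
qed

text \<open>With \<open>t = card u - 1\<close> and \<open>M = card u + d\<close>, the binomial on
  the left bounds the number of cells of weight \<open>M + \<tau>\<close>, and \<open>2 ^ E\<close>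
  is the excess of a cell. The quotient of the binomials is largest at \<open>\<tau> = 0\<close>,
  where the inequality can fail for \<open>t = 2\<close> and \<open>E = 1\<close>; hence the
  exception.\<close>

lemma binomial_growth:
  assumes E: "E = 0 \<or> E + 1 \<le> t \<and> (t \<le> 3 \<longrightarrow> E \<le> 1) \<and> E + 1 \<le> d"
    and dm: "d \<le> m" and exc: "t = 2 \<Longrightarrow> \<tau> = 0 \<Longrightarrow> E = 0"
  shows "2 ^ E * ((d + \<tau> + t) choose t) \<le> ((\<tau> + t) choose t) * (m + 1) ^ t"
proof -
  have mono: "(\<Prod>i=1..t. 1 + real d / real (\<tau> + i)) \<le> (\<Prod>i=1..t. 1 + real d / real i)"
    by (intro prod_mono) (auto intro!: divide_left_mono)
  have "2 ^ E * (\<Prod>i=1..t. 1 + real d / real (\<tau> + i)) \<le> (1 + real d) ^ t"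
  proof (cases "E = 0")
    case True
    have "(\<Prod>i=1..t. 1 + real d / real i) \<le> (\<Prod>i=1..t. 1 + real d)"
    proof (intro prod_mono conjI)
      fix i assume "i \<in> {1..t}"
      then have "real d / real i \<le> real d / 1" by (intro divide_left_mono) auto
      then show "1 + real d / real i \<le> 1 + real d" by simp
    qed simp
    then show ?thesis using mono True by simp
  next
    case False
    consider "4 \<le> t" | "t = 3" | "t = 2" using E False by force
    then show ?thesis
    proof cases
      case 1
      have "2 ^ E * (\<Prod>i=1..t. 1 + real d / real (\<tau> + i)) \<le> 2 ^ E * (\<Prod>i=1..t. 1 + real d / real i)"
        by (rule mult_left_mono[OF mono]) simp
      also have "\<dots> \<le> (1 + real d) ^ t" using prod_one_plus_le[of E t d] E 1 by simp
      finally show ?thesis .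
    next
      case 2
      have "E = 1" and d: "2 \<le> d" using E False 2 by auto
      obtain e where e: "d = 2 + e" using d le_Suc_ex by blast
      have "2 * (\<Prod>i=1..t. 1 + real d / real (\<tau> + i)) \<le> 2 * (\<Prod>i=1..t. 1 + real d / real i)"
        by (rule mult_left_mono[OF mono]) simp
      also have "(\<Prod>i=1..t. 1 + real d / real i) = (1 + real d) * (1 + real d / 2) * (1 + real d / 3)"
        by (simp add: 2 numeral_eq_Suc prod.atLeast1_atMost_eq)
      also have "2 * \<dots> \<le> (1 + real d) ^ t"
        by (simp add: 2 e power3_eq_cube field_simps)
      finally show ?thesis using \<open>E = 1\<close> by simp
    next
      case 3
      have "E = 1" and d: "2 \<le> d" using E False 3 by auto
      have \<tau>: "1 \<le> \<tau>" using exc[OF 3] False by (cases \<tau>) auto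
      obtain e where e: "d = 2 + e" using d le_Suc_ex by blast
      have "(\<Prod>i=1..t. 1 + real d / real (\<tau> + i)) \<le> (\<Prod>i=1..t. 1 + real d / real (1 + i))"
        by (intro prod_mono) (use \<tau> in \<open>auto intro!: divide_left_mono\<close>)
      also have "\<dots> = (1 + real d / 2) * (1 + real d / 3)"
        by (simp add: 3 numeral_eq_Suc prod.atLeast1_atMost_eq)
      finally have "2 * (\<Prod>i=1..t. 1 + real d / real (\<tau> + i)) \<le> 2 * ((1 + real d / 2) * (1 + real d / 3))"
        by simp
      also have "\<dots> \<le> (1 + real d) ^ t"
        by (simp add: 3 e power2_eq_square field_simps)
      finally show ?thesis using \<open>E = 1\<close> by simp
    qed
  qed
  also have "\<dots> \<le> real (m + 1) ^ t" using dm by (intro power_mono) auto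
  finally have "real ((\<tau> + t) choose t) * (2 ^ E * (\<Prod>i=1..t. 1 + real d / real (\<tau> + i))) \<le>
      real ((\<tau> + t) choose t) * real (m + 1) ^ t"
    by (rule mult_left_mono) simp
  then have "real (2 ^ E * ((d + \<tau> + t) choose t)) \<le> real (((\<tau> + t) choose t) * (m + 1) ^ t)"
    by (simp add: binomial_add_eq_prod mult_ac)
  then show ?thesis by (simp only: of_nat_le_iff)
qed

section \<open>Sizes of the cells\<close>

context poly_lattice
begin

abbreviation cell :: "(nat \<Rightarrow> nat) \<Rightarrow> (nat \<Rightarrow> 'f poly) set" where
  "cell a \<equiv> {w\<in>L. \<forall>j\<in>u. len (w j) = a j}"

definition wt :: "(nat \<Rightarrow> 'f poly) \<Rightarrow> nat" where
  "wt g = (\<Sum>j\<in>u. len (g j))"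

text \<open>The excess \<open>E\<close> comes from a tight \<open>a0 \<le> a\<close>: it is the amount by which
  \<open>dm (a0 - 1)\<close> exceeds \<open>\<Sum>a0 - M\<close>.\<close>

lemma card_cell_bound:
  assumes u: "u \<noteq> {}" and M: "\<And>g. g \<in> L \<Longrightarrow> full g \<Longrightarrow> M \<le> wt g"
    and a1: "\<And>j. j \<in> u \<Longrightarrow> 1 \<le> a j" and A: "(\<Sum>j\<in>u. a j) = M + \<tau>"
    and ne: "cell a \<noteq> {}"
  obtains E where "card (cell a) \<le> (CARD('f) - 1) ^ card u * CARD('f) ^ \<tau> * 2 ^ E"
    and "E = 0 \<or> CARD('f) < card u \<and> E + 2 \<le> card u \<and> (card u \<le> 4 \<longrightarrow> E \<le> 1) \<and> E + 1 + card u \<le> M"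
proof -
  let ?b = "CARD('f)" and ?n = "card u" and ?r = "dm (\<lambda>j. a j - 1)"
  have b2: "2 \<le> ?b" by (rule CARD_field_ge_2)
  obtain k where k: "k \<in> L" "\<And>j. j \<in> u \<Longrightarrow> len (k j) = a j" using ne by blast
  have "k \<in> box a" using k by (simp add: box_def)
  moreover have "full k" unfolding full_def
  proof
    fix j assume "j \<in> u"
    then show "k j \<noteq> 0" using k(2)[of j] a1[of j] by auto
  qed
  ultimately obtain a0 where a0: "tight a0" "\<And>j. j \<in> u \<Longrightarrow> a0 j \<le> a j"
    by (rule exists_tight) blast
  let ?s = "dm (\<lambda>j. a0 j - 1)"
  \<comment> \<open>\<open>\<delta>\<close> measures the enlargement from \<open>a0\<close> to
    \<open>a\<close> and \<open>\<tau>0\<close> the excess of \<open>a0\<close> over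
    \<open>M\<close>, so \<open>\<tau> = \<delta> + \<tau>0\<close>. The enlargement raises each of
    the two dimensions by at most \<open>\<delta>\<close>.\<close>
  define \<delta> where "\<delta> = (\<Sum>j\<in>u. a j - a0 j)"
  define \<tau>0 where "\<tau>0 = (\<Sum>j\<in>u. a0 j) - M"
  obtain k0 where k0: "k0 \<in> box a0" "full k0" using a0(1) unfolding tight_def by blast
  have "M \<le> wt k0" by (rule M[OF box_L[OF k0(1)] k0(2)])
  also have "wt k0 \<le> (\<Sum>j\<in>u. a0 j)" unfolding wt_def by (rule sum_mono) (rule box_len[OF k0(1)])
  finally have A0: "(\<Sum>j\<in>u. a0 j) = M + \<tau>0" by (simp add: \<tau>0_def)
  have "(\<Sum>j\<in>u. a j) = (\<Sum>j\<in>u. (a j - a0 j) + a0 j)"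
    by (rule sum.cong) (use a0(2) in auto)
  then have \<tau>: "\<tau> = \<delta> + \<tau>0" using A A0 by (simp add: sum.distrib \<delta>_def)
  have R: "dm a \<le> ?n + \<delta>"
    using dm_le_add[of a0 a] a0(2) tight_dm_le[OF a0(1)] by (simp add: \<delta>_def)
  have pred: "(\<Sum>j\<in>u. (a j - 1) - (a0 j - 1)) = \<delta>" unfolding \<delta>_def
  proof (rule sum.cong)
    fix j assume "j \<in> u"
    then have "1 \<le> a0 j" using a0(1) unfolding tight_def by blast
    then show "(a j - 1) - (a0 j - 1) = a j - a0 j" by simp
  qed simp
  have "?r \<le> ?s + (\<Sum>j\<in>u. (a j - 1) - (a0 j - 1))"
    by (rule dm_le_add) (use a0(2) in \<open>simp add: diff_le_mono\<close>)
  then have r: "?r \<le> ?s + \<delta>" using pred by linarith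
  have Rr: "dm a \<le> ?r + ?n"
  proof -
    have "dm a \<le> ?r + (\<Sum>j\<in>u. a j - (a j - 1))" by (rule dm_le_add) simp
    also have "(\<Sum>j\<in>u. a j - (a j - 1)) = (\<Sum>j\<in>u. 1)"
    proof (rule sum.cong)
      fix j assume "j \<in> u"
      then show "a j - (a j - 1) = 1" using a1[of j] by simp
    qed simp
    finally show ?thesis by simp
  qed
  define E where "E = ?s - \<tau>0"
  have E: "E = 0 \<or> ?b < ?n \<and> E + 2 \<le> ?n \<and> (?n \<le> 4 \<longrightarrow> E \<le> 1) \<and> E + 1 + ?n \<le> M"
  proof (cases "E = 0")
    case False
    then have "0 < ?s" by (simp add: E_def)
    from tight_rank[OF a0(1) u this] show ?thesis using False A0 by (auto simp: E_def)
  qed simp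
  have cell: "card (cell a) \<le> (?b - 1) ^ (dm a - ?r) * ?b ^ ?r" by (rule card_cell_le[OF a1])
  have "(?b - 1) ^ (dm a - ?r) * ?b ^ ?r \<le> (?b - 1) ^ ?n * ?b ^ \<tau> * 2 ^ E"
  proof (cases "?r \<le> \<tau>")
    case True
    have "(?b - 1) ^ (dm a - ?r) * ?b ^ ?r \<le> (?b - 1) ^ ?n * ?b ^ \<tau>"
      using True Rr b2 by (intro mult_mono power_increasing) auto
    also have "\<dots> \<le> (?b - 1) ^ ?n * ?b ^ \<tau> * 2 ^ E" by simp
    finally show ?thesis .
  next
    case False
    \<comment> \<open>Each of the \<open>e\<close> surplus factors \<open>b\<close> is at most
      \<open>2 * (b - 1)\<close>. The bound on \<open>dm a\<close> leaves room for \<open>e\<close>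
      more factors \<open>b - 1\<close>, so only \<open>2 ^ e\<close> is lost.\<close>
    then obtain e where e: "?r = \<tau> + e" "0 < e" by (metis less_imp_add_positive not_le)
    have eE: "e \<le> E" using e r \<tau> by (simp add: E_def)
    have en: "e \<le> ?n" using E eE e(2) by auto
    have "dm a - ?r \<le> ?n - e" using R e \<tau> by simp
    then have "(?b - 1) ^ (dm a - ?r) * ?b ^ ?r \<le> (?b - 1) ^ (?n - e) * ?b ^ ?r"
      using b2 by (intro mult_mono power_increasing) auto
    also have "\<dots> = (?b - 1) ^ (?n - e) * ?b ^ \<tau> * ?b ^ e"
      unfolding e(1) power_add by (simp only: mult_ac)
    also have "\<dots> \<le> (?b - 1) ^ (?n - e) * ?b ^ \<tau> * ((?b - 1) * 2) ^ e"
      using b2 by (intro mult_left_mono power_mono) auto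
    also have "\<dots> = ((?b - 1) ^ (?n - e) * (?b - 1) ^ e) * ?b ^ \<tau> * 2 ^ e"
      by (simp only: power_mult_distrib mult_ac)
    also have "(?b - 1) ^ (?n - e) * (?b - 1) ^ e = (?b - 1) ^ ?n"
      using en by (simp add: power_add[symmetric])
    also have "(?b - 1) ^ ?n * ?b ^ \<tau> * 2 ^ e \<le> (?b - 1) ^ ?n * ?b ^ \<tau> * 2 ^ E"
      using eE by (intro mult_left_mono power_increasing) auto
    finally show ?thesis .
  qed
  with cell E show ?thesis using that le_trans by blast
qed

lemma finite_cell: "finite (cell a)"
  by (rule finite_subset[OF _ finite_box[of a]]) (auto simp: box_def)

lemma full_wt_eq_UN_cell:
  "{g\<in>L. full g \<and> wt g = N} = (\<Union>a\<in>comps u N. cell a)"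
proof (intro subset_antisym subsetI)
  fix g assume g: "g \<in> {g\<in>L. full g \<and> wt g = N}"
  then have "(\<lambda>j. if j \<in> u then len (g j) else 0) \<in> comps u N"
    by (auto simp: comps_def full_def wt_def Suc_le_eq)
  then show "g \<in> (\<Union>a\<in>comps u N. cell a)" using g by fastforce
next
  fix g assume "g \<in> (\<Union>a\<in>comps u N. cell a)"
  then obtain a where a: "a \<in> comps u N" "g \<in> L" "\<And>j. j \<in> u \<Longrightarrow> len (g j) = a j" by auto
  have "wt g = (\<Sum>j\<in>u. a j)" unfolding wt_def by (rule sum.cong) (use a(3) in auto)
  moreover have "g j \<noteq> 0" if j: "j \<in> u" for j
  proof -
    have "1 \<le> a j" using a(1) j by (simp add: comps_def)
    then show ?thesis using a(3)[OF j] by auto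
  qed
  ultimately show "g \<in> {g\<in>L. full g \<and> wt g = N}" using a(1,2) by (auto simp: full_def comps_def)
qed

lemma card_full_wt_le:
  assumes "u \<noteq> {}"
  shows "finite {g\<in>L. full g \<and> wt g = N}"
    and "card {g\<in>L. full g \<and> wt g = N} \<le> (\<Sum>a\<in>comps u N. card (cell a))"
  unfolding full_wt_eq_UN_cell
  using card_comps_le(1)[OF finite_u assms] card_UN_le[of "comps u N" cell] finite_cell by auto

end

section \<open>Cells of minimal weight with two vectors, for two field elements and three
  coordinates\<close>

lemma len_minus [simp]: "len (- g) = len g" for g :: "'a::ab_group_add poly"
  by (simp add: len_def)

context poly_lattice
begin

text \<open>The trace of two vectors \<open>k\<close>, \<open>k'\<close> in one minimal cell:
  \<open>X = k - w\<close> and \<open>Y = k - w + v\<close>, where \<open>v = k - k'\<close> and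
  \<open>w\<close> comes from \<open>tight_cover\<close>. The lengths of their nonzero entries
  determine \<open>a\<close> up to the common shift \<open>s\<close>.\<close>

definition twin :: "nat \<Rightarrow> nat \<Rightarrow> nat \<Rightarrow> (nat \<Rightarrow> nat) \<Rightarrow> bool" where
  "twin i j l a \<longleftrightarrow> (\<exists>X\<in>L. \<exists>Y\<in>L. \<exists>s\<ge>1. X i \<noteq> 0 \<and> X j = 0 \<and> Y i = 0 \<and> Y j \<noteq> 0 \<and>
     X l = Y l \<and> X l \<noteq> 0 \<and> a i = len (X i) + s \<and> a j = len (Y j) + s \<and> a l = len (X l))"

lemma twin_sym: "twin i j l a \<Longrightarrow> twin j i l a"
  unfolding twin_def by metis

text \<open>A box of minimal weight that contains a full vector is tight. Over two elements all top
  coefficients are 1, so \<open>v = k - k'\<close> lies in the box \<open>a - 1\<close> and has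
  exactly two nonzero entries. \<open>tight_cover\<close> for \<open>z = 0\<close> and for
  \<open>z = v\<close> gives zeros of \<open>k - w\<close> and of \<open>k - w + v\<close>, at
  distinct coordinates since \<open>v i \<noteq> 0\<close>.\<close>

lemma ex_twin:
  assumes b: "CARD('f) = 2" and n: "card u = 3" and M: "\<And>g. g \<in> L \<Longrightarrow> full g \<Longrightarrow> M \<le> wt g"
    and a: "a \<in> comps u M" and two: "2 \<le> card (cell a)"
  obtains i j l where "u = {i, j, l}" "i \<noteq> j" "i \<noteq> l" "j \<noteq> l" "twin i j l a"
proof -
  have one: "x = 1" if "x \<noteq> 0" for x :: 'f
  proof -
    have "{0, 1 :: 'f} = UNIV" by (rule card_subset_eq) (use b in auto)
    then show ?thesis using that by blast
  qed
  have u: "u \<noteq> {}" using n by auto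
  have a1: "1 \<le> a i" if "i \<in> u" for i using a that by (simp add: comps_def)
  obtain k k' where k: "k \<in> cell a" and k': "k' \<in> cell a" and kk: "k \<noteq> k'"
    using two card_le_Suc0_iff_eq[OF finite_cell[of a]] by fastforce
  have kbox: "h \<in> box a" and klead: "\<And>i. i \<in> u \<Longrightarrow> coeff (h i) (a i - 1) \<noteq> 0" if "h \<in> cell a" for h
  proof -
    show "h \<in> box a" using that by (simp add: box_def)
    fix i assume "i \<in> u"
    then show "coeff (h i) (a i - 1) \<noteq> 0" using that len_eq_iff_coeff[of "h i" "a i"] a1 by simp
  qed
  have full: "full h" if "h \<in> cell a" for h
    unfolding full_def using klead[OF that] by force
  have a_tight: "tight a" unfolding tight_def
  proof (intro conjI ballI impI)
    show "\<exists>k\<in>box a. full k" using kbox[OF k] full[OF k] by blast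
  next
    fix w j assume w: "w \<in> box a" "full w" and j: "j \<in> u"
    have "len (w j) = a j"
    proof (rule ccontr)
      assume "len (w j) \<noteq> a j"
      then have "len (w j) < a j" using box_len[OF w(1) j] by simp
      then have "wt w < (\<Sum>i\<in>u. a i)"
        unfolding wt_def using box_len[OF w(1)] j finite_u by (intro sum_strict_mono_ex1) auto
      then show False using M[OF box_L[OF w(1)] w(2)] a by (simp add: comps_def)
    qed
    then show "coeff (w j) (a j - 1) \<noteq> 0" using len_eq_iff_coeff[of "w j" "a j"] a1[OF j] by simp
  qed (rule a1)
  define v where "v = k - k'"
  have v0: "v \<noteq> 0" using kk by (simp add: v_def)
  have vc: "coeff (v i) (a i - 1) = 0" if "i \<in> u" for i
    using one[OF klead[OF k that]] one[OF klead[OF k' that]] by (simp add: v_def)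
  have v: "v \<in> box (\<lambda>j. a j - 1)"
    using vc unfolding box_pred_all_iff v_def using diff_box[OF kbox[OF k] kbox[OF k']] by blast
  have vlen: "len (v i) < a i" if "i \<in> u" for i using box_len[OF v that] a1[OF that] by simp
  have "CARD('f) ^ 1 \<le> card {i\<in>u. v i \<noteq> 0}"
    by (rule tight_card_support[OF a_tight v v0]) (use vlen in \<open>simp add: Suc_le_eq\<close>)
  moreover have "card {i\<in>u. v i \<noteq> 0} < 3" using tight_support_card_less[OF a_tight u v] n by simp
  ultimately have cT: "card {i\<in>u. v i \<noteq> 0} = 2" using b by simp
  then have "card (u - {i\<in>u. v i \<noteq> 0}) = 1"
    using n finite_u by (simp add: card_Diff_subset)
  then obtain l where l: "u - {i\<in>u. v i \<noteq> 0} = {l}" by (auto simp: card_1_singleton_iff)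
  then have lu: "l \<in> u" and vl: "v l = 0" by auto
  obtain w s where w: "w \<in> box a" "\<And>i. v i = 0 \<Longrightarrow> w i = 0" "\<And>i. v i \<noteq> 0 \<Longrightarrow> len (w i) = len (v i) + s"
    "\<And>z. z \<in> box (\<lambda>j. a j - 1) \<Longrightarrow> \<exists>i\<in>u. v i \<noteq> 0 \<and> k i - w i + z i = 0"
    by (rule tight_cover[OF a_tight kbox[OF k] full[OF k] v v0]) blast
  obtain j where j: "j \<in> u" "v j \<noteq> 0" "k j - w j = 0" using w(4)[OF zero_box] by auto
  obtain i where i: "i \<in> u" "v i \<noteq> 0" "k i - w i + v i = 0" using w(4)[OF v] by auto
  have ij: "i \<noteq> j" using i j by auto
  have il: "i \<noteq> l" "j \<noteq> l" using i j vl by auto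
  have "card {i, j, l} = 3" using ij il by simp
  then have u3: "u = {i, j, l}"
    using card_subset_eq[OF finite_u, of "{i, j, l}"] i(1) j(1) lu n by simp
  define X where "X = k - w"
  define Y where "Y = k - w + v"
  have wi: "w i = k i + v i" using i(3) by (simp add: algebra_simps)
  have "coeff (w i) (a i - 1) \<noteq> 0"
    unfolding wi coeff_add vc[OF i(1)] using klead[OF k i(1)] by simp
  then have ai: "a i = len (v i) + s"
    using len_eq_iff_coeff[OF box_len[OF w(1) i(1)] a1[OF i(1)]] w(3)[OF i(2)] by simp
  have aj: "a j = len (v j) + s" using w(3)[OF j(2)] j(3) k j(1) by auto
  have "X \<in> L" "Y \<in> L" unfolding X_def Y_def
    using k box_L[OF w(1)] box_L[OF v] by (auto intro!: diff_mem add_mem)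
  moreover have "X j = 0" "Y i = 0" using i(3) j(3) by (simp_all add: X_def Y_def)
  moreover have Xi: "X i = - v i" using i(3) by (simp add: X_def wi)
  moreover have Yj: "Y j = v j" using j(3) by (simp add: Y_def)
  moreover have "X l = k l" "Y l = k l" using vl w(2)[OF vl] by (simp_all add: X_def Y_def)
  moreover have "k l \<noteq> 0" using full[OF k] lu by (simp add: full_def)
  moreover have "1 \<le> s" using vlen[OF j(1)] aj by simp
  moreover have "a l = len (k l)" using k lu by simp
  ultimately have "twin i j l a" unfolding twin_def using ai aj i(2) j(2) by (metis len_minus neg_equal_0_iff_equal)
  then show ?thesis using that[OF u3 ij il(1) il(2)] by blast
qed

text \<open>If the data differ, combinations such as \<open>X' - Y\<close> and
  \<open>X - X' + Y'\<close> have no zero entry, hence weight at least \<open>M\<close>; this is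
  incompatible with the assumed weight bounds.\<close>

lemma twin_data_unique:
  assumes u: "u = {i, j, l}" "i \<noteq> j" "i \<noteq> l" "j \<noteq> l"
    and M: "\<And>g. g \<in> L \<Longrightarrow> full g \<Longrightarrow> M \<le> wt g"
    and X: "X \<in> L" "X i \<noteq> 0" "X j = 0" and Y: "Y \<in> L" "Y i = 0" "Y j \<noteq> 0"
    and XY: "X l = Y l" "X l \<noteq> 0" "len (X i) + len (Y j) + len (X l) + 2 \<le> M"
    and X': "X' \<in> L" "X' i \<noteq> 0" "X' j = 0" and Y': "Y' \<in> L" "Y' i = 0" "Y' j \<noteq> 0"
    and XY': "X' l = Y' l" "X' l \<noteq> 0" "len (X' i) + len (Y' j) + len (X' l) + 2 \<le> M"
  shows "X i = X' i \<and> Y j = Y' j \<and> X l = X' l"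
proof -
  have wt: "M \<le> len (g i) + len (g j) + len (g l)"
    if "g \<in> L" "g i \<noteq> 0" "g j \<noteq> 0" "g l \<noteq> 0" for g
  proof -
    have "M \<le> (\<Sum>x\<in>u. len (g x))"
      using M[OF that(1)] that u(1) unfolding full_def wt_def by blast
    then show ?thesis using u by simp
  qed
  \<comment> \<open>Stated for arbitrary pairs so that the roles can be exchanged and
    \<open>X l\<close> taken as the shorter entry. Then \<open>X' - Y\<close> and
    \<open>X - Y'\<close> force \<open>Y' j\<close> and \<open>X' i\<close> to be shorter than
    \<open>Y j\<close> and \<open>X i\<close>, and \<open>X - X' + Y'\<close>, whose entry at
    \<open>l\<close> is \<open>X l\<close>, is too light.\<close>
  have no: False if ne: "X l \<noteq> X' l" and le: "len (X l) \<le> len (X' l)"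
    and X: "X \<in> L" "X i \<noteq> 0" "X j = 0" and Y: "Y \<in> L" "Y i = 0" "Y j \<noteq> 0"
    and XY: "X l = Y l" "X l \<noteq> 0" "len (X i) + len (Y j) + len (X l) + 2 \<le> M"
    and X': "X' \<in> L" "X' i \<noteq> 0" "X' j = 0" and Y': "Y' \<in> L" "Y' i = 0" "Y' j \<noteq> 0"
    and XY': "X' l = Y' l" "X' l \<noteq> 0" "len (X' i) + len (Y' j) + len (X' l) + 2 \<le> M"
    for X Y X' Y'
  proof -
    have "M \<le> len (X' i) + len (Y j) + len (X' l)"
      using wt[OF diff_mem[OF X'(1) Y(1)]] X Y X' Y' XY XY' ne
        len_diff_le[OF order_refl[of "len (X' l)"] le] by auto
    moreover have "M \<le> len (X i) + len (Y' j) + len (X' l)"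
      using wt[OF diff_mem[OF X(1) Y'(1)]] X Y X' Y' XY XY' ne
        len_diff_le[OF le order_refl[of "len (X' l)"]] by auto
    ultimately have q: "len (Y' j) < len (Y j)" and p: "len (X' i) < len (X i)" using XY' by auto
    have pne: "X i \<noteq> X' i" using p by auto
    have "M \<le> len (X i - X' i) + len (Y' j) + len (X l)"
      using wt[OF add_mem[OF diff_mem[OF X(1) X'(1)] Y'(1)]] X X' Y' XY XY' pne by auto
    moreover have "len (X i - X' i) \<le> len (X i)" using p by (intro len_diff_le) auto
    ultimately show False using XY q by linarith
  qed
  have l: "X l = X' l"
    using no[of X X' Y Y', OF _ _ X Y XY X' Y' XY'] no[of X' X Y' Y, OF _ _ X' Y' XY' X Y XY]
    by (metis nat_le_linear)
  have l': "Y l = X l" "X' l = X l" "Y' l = X l" using l XY(1) XY'(1) by simp_all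
  have i: "X i = X' i"
  proof (rule ccontr)
    assume ne: "X i \<noteq> X' i"
    have 1: "M \<le> len (X i - X' i) + len (Y' j) + len (X l)"
      using wt[OF add_mem[OF diff_mem[OF X(1) X'(1)] Y'(1)]] Y'(2,3) X(3) X'(3) XY(2) ne
      by (simp add: l')
    have 2: "M \<le> len (X i - X' i) + len (Y j) + len (X l)"
      using wt[OF add_mem[OF diff_mem[OF X(1) X'(1)] Y(1)]] Y(2,3) X(3) X'(3) XY(2) ne
      by (simp add: l')
    show False
    proof (cases "len (X i) \<le> len (X' i)")
      case True
      then have "len (X i - X' i) \<le> len (X' i)" by (intro len_diff_le) auto
      then show False using 1 XY' l by auto
    next
      case False
      then have "len (X i - X' i) \<le> len (X i)" by (intro len_diff_le) auto
      then show False using 2 XY by auto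
    qed
  qed
  have j: "Y j = Y' j"
  proof (rule ccontr)
    assume ne: "Y j \<noteq> Y' j"
    have 1: "M \<le> len (X' i) + len (Y j - Y' j) + len (X l)"
      using wt[OF add_mem[OF diff_mem[OF Y(1) Y'(1)] X'(1)]] X'(2,3) Y(2) Y'(2) XY(2) ne
      by (simp add: l')
    have 2: "M \<le> len (X i) + len (Y j - Y' j) + len (X l)"
      using wt[OF add_mem[OF diff_mem[OF Y(1) Y'(1)] X(1)]] X(2,3) Y(2) Y'(2) XY(2) ne
      by (simp add: l')
    show False
    proof (cases "len (Y j) \<le> len (Y' j)")
      case True
      then have "len (Y j - Y' j) \<le> len (Y' j)" by (intro len_diff_le) auto
      then show False using 1 XY' l by auto
    next
      case False
      then have "len (Y j - Y' j) \<le> len (Y j)" by (intro len_diff_le) auto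
      then show False using 2 XY by auto
    qed
  qed
  show ?thesis using i j l by blast
qed

text \<open>The entries of \<open>X\<close> and \<open>Y\<close> fix \<open>a\<close> up to
  \<open>s\<close>, and the total \<open>M\<close> fixes \<open>s\<close>. The bound 5 is 2 + 2 + 1:
  two parts of \<open>a\<close> exceed a positive length by \<open>s \<ge> 1\<close>.\<close>

lemma twin_unique:
  assumes u: "u = {i, j, l}" "i \<noteq> j" "i \<noteq> l" "j \<noteq> l"
    and M: "\<And>g. g \<in> L \<Longrightarrow> full g \<Longrightarrow> M \<le> wt g"
    and a: "a \<in> comps u M" "twin i j l a" and a': "a' \<in> comps u M" "twin i j l a'"
  shows "a = a'" and "5 \<le> M"
proof -
  have sum: "c i + c j + c l = M" if "c \<in> comps u M" for c
    using that u by (auto simp: comps_def)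
  obtain X Y s where X: "X \<in> L" "X i \<noteq> 0" "X j = 0" and Y: "Y \<in> L" "Y i = 0" "Y j \<noteq> 0"
    and XY: "X l = Y l" "X l \<noteq> 0" and s: "1 \<le> s"
    and ea: "a i = len (X i) + s" "a j = len (Y j) + s" "a l = len (X l)"
    using a(2) unfolding twin_def by blast
  obtain X' Y' s' where X': "X' \<in> L" "X' i \<noteq> 0" "X' j = 0" and Y': "Y' \<in> L" "Y' i = 0" "Y' j \<noteq> 0"
    and XY': "X' l = Y' l" "X' l \<noteq> 0" and s': "1 \<le> s'"
    and ea': "a' i = len (X' i) + s'" "a' j = len (Y' j) + s'" "a' l = len (X' l)"
    using a'(2) unfolding twin_def by blast
  have "len (X i) + len (Y j) + len (X l) + 2 \<le> M" using sum[OF a(1)] ea s by simp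
  moreover have "len (X' i) + len (Y' j) + len (X' l) + 2 \<le> M" using sum[OF a'(1)] ea' s' by simp
  ultimately have eq: "X i = X' i \<and> Y j = Y' j \<and> X l = X' l"
    using twin_data_unique[OF u M X Y XY _ X' Y' XY'] by blast
  then have "s = s'" using sum[OF a(1)] sum[OF a'(1)] ea ea' by simp
  then have "a x = a' x" if "x \<in> u" for x using that u(1) eq ea ea' by auto
  moreover have "a x = a' x" if "x \<notin> u" for x using that a(1) a'(1) by (simp add: comps_def)
  ultimately show "a = a'" by blast
  have "0 < len (X i)" "0 < len (Y j)" "0 < len (X l)" using X Y XY by simp_all
  then show "5 \<le> M" using sum[OF a(1)] ea s by linarith
qed

text \<open>For \<open>b = 2\<close> and three coordinates a cell of minimal weight can contain two vectors, and then the
  cellwise estimate is too weak. Such a cell is determined by the coordinate \<open>l\<close> in which its two vectors agree, so there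
  are at most three of them.\<close>

lemma card_full_min_wt_le:
  assumes b: "CARD('f) = 2" and n: "card u = 3" and M: "\<And>g. g \<in> L \<Longrightarrow> full g \<Longrightarrow> M \<le> wt g"
    and Mm: "M \<le> 3 + m" and M3: "3 \<le> M"
  shows "card {g\<in>L. full g \<and> wt g = M} \<le> (m + 1)\<^sup>2"
proof -
  have u: "u \<noteq> {}" using n by auto
  note finC = card_comps_le(1)[OF finite_u u, of M]
  define TW where "TW = {a\<in>comps u M. 2 \<le> card (cell a)}"
  have cell2: "card (cell a) \<le> 2" if a: "a \<in> comps u M" for a
  proof (cases "cell a = {}")
    case False
    obtain E where E: "card (cell a) \<le> (CARD('f) - 1) ^ card u * CARD('f) ^ 0 * 2 ^ E"
      "E = 0 \<or> CARD('f) < card u \<and> E + 2 \<le> card u \<and> (card u \<le> 4 \<longrightarrow> E \<le> 1) \<and> E + 1 + card u \<le> M"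
      by (rule card_cell_bound[where M = M and \<tau> = 0, OF u M _ _ False]) (use a in \<open>auto simp: comps_def\<close>)
    then have "E \<le> 1" using n by auto
    then have "(2::nat) ^ E \<le> 2 ^ 1" by (rule power_increasing) simp
    then show ?thesis using E(1) b by simp
  next
    case True
    then show ?thesis by (simp only: card.empty)
  qed
  have "\<exists>i j l. u = {i, j, l} \<and> i \<noteq> j \<and> i \<noteq> l \<and> j \<noteq> l \<and> twin i j l a" if "a \<in> TW" for a
    using ex_twin[where M = M and a = a, OF b n M] that unfolding TW_def by blast
  then obtain I J K where IJK: "\<And>a. a \<in> TW \<Longrightarrow> u = {I a, J a, K a} \<and> I a \<noteq> J a \<and> I a \<noteq> K a \<and>
      J a \<noteq> K a \<and> twin (I a) (J a) (K a) a"
    by metis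
  have inj: "inj_on K TW"
  proof (rule inj_onI)
    fix a a' assume a: "a \<in> TW" and a': "a' \<in> TW" and K: "K a = K a'"
    have "{I a, J a} = u - {K a}" "{I a', J a'} = u - {K a}"
      using IJK[OF a] IJK[OF a'] K by auto
    then have "{I a, J a} = {I a', J a'}" by simp
    then consider "I a = I a'" "J a = J a'" | "I a = J a'" "J a = I a'"
      by (auto simp: doubleton_eq_iff)
    then have "twin (I a) (J a) (K a) a'" using IJK[OF a'] K twin_sym by cases auto
    then show "a = a'" using twin_unique(1)[where M = M, OF _ _ _ _ M] IJK[OF a] a a' by (auto simp: TW_def)
  qed
  have TW3: "card TW \<le> 3"
    using card_inj_on_le[OF inj, of u] IJK finite_u n by auto
  have M5: "5 \<le> M" if "a \<in> TW" for a
    using twin_unique(2)[where M = M and i = "I a" and j = "J a" and l = "K a" and a = a and a' = a, OF _ _ _ _ M] IJK[OF that] that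
    by (auto simp: TW_def)
  have finTW: "finite TW" using finC by (simp add: TW_def)
  obtain d where d: "M = 3 + d" using M3 le_Suc_ex by blast
  have "card {g\<in>L. full g \<and> wt g = M} \<le> (\<Sum>a\<in>comps u M. card (cell a))"
    by (rule card_full_wt_le(2)[OF u])
  also have "\<dots> \<le> (\<Sum>a\<in>comps u M. 1 + (if a \<in> TW then 1 else 0))"
    by (rule sum_mono) (use cell2 in \<open>force simp: TW_def\<close>)
  also have "\<dots> = card (comps u M) + card TW"
  proof -
    have "(\<Sum>a\<in>comps u M. if a \<in> TW then 1 else 0) = card (comps u M \<inter> TW)"
      using finC by (simp add: sum.If_cases)
    also have "comps u M \<inter> TW = TW" by (auto simp: TW_def)
    finally show ?thesis by (simp only: sum.distrib) simp
  qed
  also have "\<dots> \<le> ((d + 2) choose 2) + card TW"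
    using card_comps_le(2)[OF finite_u u, of M] n d by (simp add: numeral_2_eq_2)
  also have "\<dots> \<le> (d + 1)\<^sup>2"
  proof -
    have ch: "2 * ((d + 2) choose 2) = (d + 2) * (d + 1)"
      by (simp add: choose_two)
    show ?thesis
    proof (cases "TW = {}")
      case True
      have "(d + 2) * (d + 1) \<le> 2 * (d + 1)\<^sup>2" by (simp add: power2_eq_square)
      then show ?thesis using ch True by simp
    next
      case False
      then have "2 \<le> d" using M5 d by auto
      then obtain e where "d = 2 + e" using le_Suc_ex by blast
      \<comment> \<open>6 is twice the bound on \<open>card TW\<close>. Equality holds at
        \<open>d = 2\<close>, so \<open>5 \<le> M\<close> is just enough.\<close>
      then have "(d + 2) * (d + 1) + 6 \<le> 2 * (d + 1)\<^sup>2" by (simp add: power2_eq_square algebra_simps)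
      then show ?thesis using ch TW3 by linarith
    qed
  qed
  also have "\<dots> \<le> (m + 1)\<^sup>2" using Mm d by (intro power_mono) auto
  finally show ?thesis .
qed

text \<open>There are at most \<open>C\<close> cells, and each holds at most the fraction
  \<open>1 / C\<close> of the bound by \<open>card_cell_bound\<close> and
  \<open>binomial_growth\<close>. For three coordinates a positive \<open>E\<close> requires
  \<open>CARD('f) < 3\<close>, so the exception of \<open>binomial_growth\<close> concerns only the
  field with two elements.\<close>

lemma card_full_wt_bound:
  assumes u: "u \<noteq> {}" and M: "\<And>g. g \<in> L \<Longrightarrow> full g \<Longrightarrow> M \<le> wt g"
    and nM: "card u \<le> M" and Mm: "M \<le> card u + m"
  shows "card {g\<in>L. full g \<and> wt g = M + \<tau>} \<le>
    (CARD('f) - 1) ^ card u * CARD('f) ^ \<tau> * ((\<tau> + (card u - 1)) choose (card u - 1)) * (m + 1) ^ (card u - 1)"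
    (is "_ \<le> ?B")
proof (cases "CARD('f) = 2 \<and> card u = 3 \<and> \<tau> = 0")
  case True
  then show ?thesis using card_full_min_wt_le[where M = M and m = m, OF _ _ M] nM Mm
    by (simp add: numeral_2_eq_2)
next
  case False
  define t where "t = card u - 1"
  define d where "d = M - card u"
  have n: "card u = Suc t" using u finite_u by (simp add: t_def card_gt_0_iff)
  have Md: "M = Suc t + d" using nM n by (simp add: d_def)
  define C where "C = ((d + \<tau> + t) choose t)"
  have C0: "0 < C" by (simp add: C_def)
  have cell: "card (cell a) * C \<le> ?B" if a: "a \<in> comps u (M + \<tau>)" for a
  proof (cases "cell a = {}")
    case ne: False
    obtain E where E: "card (cell a) \<le> (CARD('f) - 1) ^ card u * CARD('f) ^ \<tau> * 2 ^ E"
      "E = 0 \<or> CARD('f) < card u \<and> E + 2 \<le> card u \<and> (card u \<le> 4 \<longrightarrow> E \<le> 1) \<and> E + 1 + card u \<le> M"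
      by (rule card_cell_bound[where M = M and \<tau> = \<tau>, OF u M _ _ ne]) (use a in \<open>auto simp: comps_def\<close>)
    have "2 ^ E * C \<le> ((\<tau> + t) choose t) * (m + 1) ^ t"
      unfolding C_def
    proof (rule binomial_growth)
      show "E = 0 \<or> E + 1 \<le> t \<and> (t \<le> 3 \<longrightarrow> E \<le> 1) \<and> E + 1 \<le> d" using E(2) n Md by auto
      show "d \<le> m" using Mm Md n by simp
      assume "t = 2" "\<tau> = 0"
      then show "E = 0" using False E(2) n CARD_field_ge_2[where ?'f = 'f] by auto
    qed
    then have "((CARD('f) - 1) ^ card u * CARD('f) ^ \<tau>) * (2 ^ E * C) \<le>
        ((CARD('f) - 1) ^ card u * CARD('f) ^ \<tau>) * (((\<tau> + t) choose t) * (m + 1) ^ t)"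
      by (rule mult_le_mono2)
    moreover have "card (cell a) * C \<le> ((CARD('f) - 1) ^ card u * CARD('f) ^ \<tau>) * (2 ^ E * C)"
      using mult_le_mono1[OF E(1), of C] by (simp only: mult.assoc)
    ultimately have "card (cell a) * C \<le>
        ((CARD('f) - 1) ^ card u * CARD('f) ^ \<tau>) * (((\<tau> + t) choose t) * (m + 1) ^ t)"
      by linarith
    then show ?thesis by (simp only: t_def mult.assoc)
  next
    case True
    then show ?thesis by (simp only: card.empty)
  qed
  have "(\<Sum>a\<in>comps u (M + \<tau>). card (cell a)) * C \<le> (\<Sum>a\<in>comps u (M + \<tau>). ?B)"
    unfolding sum_distrib_right by (rule sum_mono) (rule cell)
  also have "\<dots> = card (comps u (M + \<tau>)) * ?B" by simp
  also have "\<dots> \<le> C * ?B"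
  proof (rule mult_le_mono1)
    have "M + \<tau> - 1 = d + \<tau> + t" using Md by simp
    then show "card (comps u (M + \<tau>)) \<le> C"
      using card_comps_le(2)[OF finite_u u, of "M + \<tau>"] by (simp add: C_def n)
  qed
  finally have "(\<Sum>a\<in>comps u (M + \<tau>). card (cell a)) \<le> ?B" using C0 by simp
  then show ?thesis using card_full_wt_le(2)[OF u, of "M + \<tau>"] by linarith
qed

end

section \<open>The dual net as a module\<close>

text \<open>Process the coordinates one by one. Modulo the ideal \<open>(d)\<close> of what the previous
  coordinates can still correct, the new coordinate is determined modulo \<open>h = d / gcd d (q i)\<close>, so it has a
  nonzero representative of length at most \<open>degree h + 1\<close>; the degrees of the \<open>h\<close> add up to at most
  \<open>degree p\<close>.\<close>

lemma ex_nonzero_solution: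
  fixes p :: "'f::field poly"
  assumes "finite u" and p: "p \<noteq> 0"
  shows "\<exists>d. d \<noteq> 0 \<and> (\<forall>t. d dvd t \<longrightarrow> (\<exists>g. (\<forall>j\<in>u. g j \<noteq> 0) \<and>
    p dvd (\<Sum>j\<in>u. g j * q j) - t \<and> (\<Sum>j\<in>u. len (g j)) + degree d \<le> degree p + card u))"
  using assms(1)
proof (induction u rule: finite_induct)
  case empty
  then show ?case using p by (intro exI[of _ p]) simp
next
  case (insert i u)
  then obtain d where d: "d \<noteq> 0"
    and IH: "\<forall>t. d dvd t \<longrightarrow> (\<exists>g. (\<forall>j\<in>u. g j \<noteq> 0) \<and>
      p dvd (\<Sum>j\<in>u. g j * q j) - t \<and> (\<Sum>j\<in>u. len (g j)) + degree d \<le> degree p + card u)"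
    by blast
  obtain d' x y where d': "d' = x * d + y * q i" "d' dvd d" "d' dvd q i" using poly_bezout by blast
  obtain h where h: "d = d' * h" using d'(2) by blast
  obtain e where e: "q i = d' * e" using d'(3) by blast
  have nz: "d' \<noteq> 0" "h \<noteq> 0" using d h by auto
  have deg: "degree d = degree d' + degree h" using nz h by (simp add: degree_mult_eq)
  show ?case
  proof (intro exI[of _ d'] conjI allI impI)
    show "d' \<noteq> 0" by fact
    fix t assume "d' dvd t"
    then obtain r where r: "t = d' * r" by blast
    \<comment> \<open>\<open>y * q i\<close> is \<open>d'\<close> modulo \<open>d\<close>, so
      \<open>y * r\<close> solves the congruence for \<open>c\<close>, and reduction modulo
      \<open>h\<close> preserves this. A zero residue is replaced by \<open>h\<close> itself, which
      costs the extra 1 in the length.\<close>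
    define c where "c = (if y * r mod h = 0 then h else y * r mod h)"
    have c0: "c \<noteq> 0" using nz by (simp add: c_def)
    have lc: "len c \<le> degree h + 1"
      using degree_mod_less[OF nz(2), of "y * r"] by (auto simp: c_def len_def)
    have "h dvd y * r - c"
      by (auto simp: c_def mod_eq_0_iff_dvd minus_mod_eq_mult_div)
    then obtain w where w: "y * r - c = h * w" by blast
    have "t - c * q i = r * (d' - y * q i) + (y * r - c) * q i" by (simp add: r algebra_simps)
    also have "d' - y * q i = x * d" using d'(1) by (metis add_diff_cancel_right')
    also have "r * (x * d) + (y * r - c) * q i = d * (r * x + w * e)"
      unfolding w by (simp add: e h algebra_simps)
    finally have "d dvd t - c * q i" by simp
    then obtain g where g: "\<forall>j\<in>u. g j \<noteq> 0" "p dvd (\<Sum>j\<in>u. g j * q j) - (t - c * q i)"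
      "(\<Sum>j\<in>u. len (g j)) + degree d \<le> degree p + card u"
      using IH[rule_format, of "t - c * q i"] by blast
    define g' where "g' = g(i := c)"
    have "(\<Sum>j\<in>u. g' j * q j) = (\<Sum>j\<in>u. g j * q j)" "(\<Sum>j\<in>u. len (g' j)) = (\<Sum>j\<in>u. len (g j))"
      using insert.hyps by (auto simp: g'_def intro!: sum.cong)
    then have "(\<Sum>j\<in>insert i u. g' j * q j) - t = (\<Sum>j\<in>u. g j * q j) - (t - c * q i)"
      "(\<Sum>j\<in>insert i u. len (g' j)) = len c + (\<Sum>j\<in>u. len (g j))"
      using insert.hyps by (simp_all add: g'_def)
    moreover have "\<forall>j\<in>insert i u. g' j \<noteq> 0" using g(1) c0 by (simp add: g'_def)
    moreover have "card (insert i u) = card u + 1" using insert.hyps by simp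
    ultimately show "\<exists>g. (\<forall>j\<in>insert i u. g j \<noteq> 0) \<and> p dvd (\<Sum>j\<in>insert i u. g j * q j) - t \<and>
        (\<Sum>j\<in>insert i u. len (g j)) + degree d' \<le> degree p + card (insert i u)"
      using g lc deg by (intro exI[of _ g']) (simp add: algebra_simps)
  qed
qed

definition syz :: "'f::field poly \<Rightarrow> (nat \<Rightarrow> 'f poly) \<Rightarrow> nat set \<Rightarrow> (nat \<Rightarrow> 'f poly) set" where
  "syz p q u = {g. (\<forall>j. j \<notin> u \<longrightarrow> g j = 0) \<and> p dvd (\<Sum>j\<in>u. g j * q j)}"

lemma poly_lattice_syz: "finite u \<Longrightarrow> poly_lattice u (syz (p :: 'f::{field,finite} poly) q u)"
proof
  fix g h assume "g \<in> syz p q u" "h \<in> syz p q u"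
  then show "g - h \<in> syz p q u"
    by (simp add: syz_def left_diff_distrib sum_subtractf dvd_diff)
next
  fix g f assume "g \<in> syz p q u"
  then show "(\<lambda>j. f * g j) \<in> syz p q u"
    by (simp add: syz_def mult.assoc flip: sum_distrib_left)
qed (auto simp: syz_def)

text \<open>No digit is lost: all digits of \<open>k\<close> from the \<open>k\<close>-th on vanish.\<close>

definition digit_poly :: "nat \<Rightarrow> 'f::{field,finite} poly" where
  "digit_poly k = tr CARD('f) k k"

lemma coeff_tr: "coeff (tr b m k) i = (if i < m then of_nat (digit b k i) else 0)"
proof -
  have "coeff (tr b m k) i = (\<Sum>j<m. if j = i then of_nat (digit b k j) else 0)"
    by (simp add: tr_def coeff_sum)
  then show ?thesis by (simp add: sum.delta)
qed

lemma coeff_digit_poly: "coeff (digit_poly k :: 'f::{field,finite} poly) i = of_nat (digit CARD('f) k i)"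
proof (cases "i < k")
  case False
  have "k < 2 ^ k" by (rule less_exp)
  also have "(2::nat) ^ k \<le> CARD('f) ^ i"
    using False CARD_field_ge_2[where ?'f = 'f]
    by (meson le_trans not_le_imp_less not_less power_increasing power_mono zero_le one_le_numeral)
  finally have "digit CARD('f) k i = 0" by (simp add: digit_def)
  then show ?thesis using False by (simp add: digit_poly_def coeff_tr)
qed (simp add: digit_poly_def coeff_tr)

lemma digit_0: "digit b k 0 = k mod b"
  by (simp add: digit_def)

lemma digit_Suc: "digit b k (Suc i) = digit b (k div b) i"
  by (simp add: digit_def div_mult2_eq)

lemma digit_add: "digit b k (m + i) = digit b (k div b ^ m) i"
  by (simp add: digit_def power_add div_mult2_eq)

lemma digit_poly_rec:
  "digit_poly k = pCons (of_nat (k mod CARD('f))) (digit_poly (k div CARD('f)) :: 'f::{field,finite} poly)"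
  by (rule poly_eqI) (simp add: coeff_digit_poly coeff_pCons digit_0 digit_Suc split: nat.split)

section \<open>Digit polynomials over a prime field\<close>

context
  assumes prime_card: "prime CARD('f::{field,finite})"
begin

lemma of_nat_field_inj: "i < CARD('f) \<Longrightarrow> j < CARD('f) \<Longrightarrow> (of_nat i :: 'f) = of_nat j \<longleftrightarrow> i = j"
  using bij_betw_of_nat_prime_field[OF prime_card] by (auto simp: bij_betw_def inj_on_def)

lemma of_nat_digit_eq_0: "(of_nat (digit CARD('f) k i) :: 'f) = 0 \<longleftrightarrow> digit CARD('f) k i = 0"
  using of_nat_field_inj[of "digit CARD('f) k i" 0] by (simp add: digit_def)

lemma digit_poly_inj: "(digit_poly k :: 'f poly) = digit_poly l \<Longrightarrow> k = l"
proof (induction "k + l" arbitrary: k l rule: less_induct)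
  case less
  show ?case
  proof (cases "k = 0 \<and> l = 0")
    case False
    let ?b = "CARD('f)"
    have b: "1 < ?b" using CARD_field_ge_2[where ?'f = 'f] by simp
    have eq: "pCons (of_nat (k mod ?b)) (digit_poly (k div ?b) :: 'f poly) =
        pCons (of_nat (l mod ?b)) (digit_poly (l div ?b))"
      using less.prems by (simp add: digit_poly_rec[symmetric])
    have le: "k div ?b \<le> k" "l div ?b \<le> l" by simp_all
    have "k div ?b + l div ?b < k + l"
    proof (cases "k = 0")
      case True
      then show ?thesis using False b by simp
    next
      case False
      then show ?thesis using b le by (intro add_less_le_mono) simp_all
    qed
    then have "k div ?b = l div ?b" using less.hyps eq by simp
    moreover have "k mod ?b = l mod ?b" using eq b of_nat_field_inj by simp
    ultimately show ?thesis by (metis div_mult_mod_eq)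
  qed simp
qed

lemma digit_poly_surj: "\<exists>k. digit_poly k = (g :: 'f poly)"
proof (induction g)
  case 0
  show ?case by (intro exI[of _ 0] poly_eqI) (simp add: coeff_digit_poly digit_def)
next
  case (pCons c g)
  then obtain k where k: "digit_poly k = g" by blast
  obtain n where n: "n < CARD('f)" "of_nat n = c"
    using bij_betw_of_nat_prime_field[OF prime_card] unfolding bij_betw_def
    by (metis UNIV_I imageE lessThan_iff)
  have "digit_poly (n + CARD('f) * k) = pCons c g"
    using n k by (subst digit_poly_rec) simp
  then show ?case by blast
qed

lemma len_digit_poly:
  assumes "1 \<le> k"
  shows "len (digit_poly k :: 'f poly) = mu CARD('f) k"
proof -
  have 0: "digit_poly 0 = (0 :: 'f poly)"
    by (rule poly_eqI) (simp add: coeff_digit_poly digit_def)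
  have ne: "digit_poly k \<noteq> (0 :: 'f poly)" using digit_poly_inj[of k 0] 0 assms by auto
  have "{i. digit CARD('f) k i \<noteq> 0} = {i. coeff (digit_poly k :: 'f poly) i \<noteq> 0}"
    by (simp add: coeff_digit_poly of_nat_digit_eq_0)
  moreover have "Max {i. coeff (digit_poly k :: 'f poly) i \<noteq> 0} = degree (digit_poly k :: 'f poly)"
    by (rule Max_eqI)
      (use ne in \<open>auto intro: le_degree finite_subset[of _ "{..degree (digit_poly k :: 'f poly)}"]\<close>)
  ultimately show ?thesis using ne by (simp add: mu_def len_def)
qed

text \<open>The product has length \<open>m + len s\<close>, which exceeds that of \<open>r\<close>,
  so nothing cancels at the top. Both \<open>p\<close> and x^m serve as the multiplier, so
  exchanging them preserves lengths.\<close>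

lemma len_add_mult:
  assumes p: "degree (p :: 'f poly) = m" "p \<noteq> 0" and r: "len r \<le> m" and s: "s \<noteq> 0"
  shows "len (r + p * s) = m + len s"
proof -
  have ps: "degree (p * s) = m + degree s" using p s by (simp add: degree_mult_eq)
  have "coeff (r + p * s) (m + degree s) = coeff (p * s) (m + degree s)"
    using coeff_len_eq_0[OF r, of "m + degree s"] by simp
  also have "\<dots> \<noteq> 0" using ps p s by (metis leading_coeff_0_iff mult_eq_0_iff)
  finally have c: "coeff (r + p * s) (m + len s - 1) \<noteq> 0" using s by (simp add: len_def)
  have l: "len (p * s) = m + len s" using p s ps by (simp add: len_def)
  have "len (r + p * s) \<le> m + len s" by (rule len_add_le) (use r l in auto)
  then show ?thesis using c s by (subst len_eq_iff_coeff) (auto simp: Suc_le_eq)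
qed

lemma len_tr: "len (tr b m k :: 'f poly) \<le> m"
  by (simp add: len_le_iff coeff_tr)

lemma tr_eq_digit_poly:
  assumes "k div CARD('f) ^ m = 0"
  shows "tr CARD('f) m k = (digit_poly k :: 'f poly)"
proof (rule poly_eqI)
  fix i
  have "digit CARD('f) k i = 0" if "m \<le> i"
    using digit_add[of "CARD('f)" k m "i - m"] that assms by (simp add: digit_def)
  then show "coeff (tr CARD('f) m k) i = coeff (digit_poly k :: 'f poly) i"
    by (simp add: coeff_tr coeff_digit_poly)
qed

lemma digit_poly_split:
  "digit_poly k = tr CARD('f) m k + monom 1 m * (digit_poly (k div CARD('f) ^ m) :: 'f poly)"
proof (rule poly_eqI)
  fix i
  show "coeff (digit_poly k) i =
      coeff (tr CARD('f) m k + monom 1 m * (digit_poly (k div CARD('f) ^ m) :: 'f poly)) i"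
    using digit_add[of "CARD('f)" k m "i - m"]
    by (auto simp: coeff_digit_poly coeff_tr coeff_monom_mult)
qed

text \<open>In \<open>tr\<close> the digits of \<open>k\<close> from the \<open>m\<close>-th on are free; making them the coefficients of \<open>p x\<^sup>i\<close> keeps the
  residue modulo \<open>p\<close> and preserves the length.\<close>

definition lift_poly :: "'f poly \<Rightarrow> nat \<Rightarrow> nat \<Rightarrow> 'f poly" where
  "lift_poly p m k = tr CARD('f) m k + p * digit_poly (k div CARD('f) ^ m)"

lemma len_lift_poly:
  assumes p: "degree p = m" "p \<noteq> 0" and k: "1 \<le> k"
  shows "len (lift_poly p m k) = mu CARD('f) k"
proof (cases "k div CARD('f) ^ m = 0")
  case True
  have "digit_poly 0 = (0 :: 'f poly)"
    by (rule poly_eqI) (simp add: coeff_digit_poly digit_def)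
  then have "lift_poly p m k = digit_poly k" using True by (simp add: lift_poly_def tr_eq_digit_poly)
  then show ?thesis using len_digit_poly[OF k] by simp
next
  case False
  let ?s = "digit_poly (k div CARD('f) ^ m) :: 'f poly"
  have "len ?s = mu CARD('f) (k div CARD('f) ^ m)" using len_digit_poly[of "k div CARD('f) ^ m"] False by simp
  also have "0 < \<dots>" by (simp add: mu_def)
  finally have s: "?s \<noteq> 0" by auto
  have "len (lift_poly p m k) = m + len ?s"
    unfolding lift_poly_def by (rule len_add_mult[OF p len_tr s])
  also have "\<dots> = len (digit_poly k :: 'f poly)"
    unfolding digit_poly_split[of k m]
    by (rule len_add_mult[symmetric, OF _ _ len_tr s]) (simp_all add: degree_monom_eq)
  finally show ?thesis using len_digit_poly[OF k] by simp
qed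

lemma lift_poly_cong: "p dvd (\<Sum>j\<in>u. lift_poly p m (k j) * q j) \<longleftrightarrow> p dvd (\<Sum>j\<in>u. tr CARD('f) m (k j) * q j)"
proof -
  have "(\<Sum>j\<in>u. lift_poly p m (k j) * q j) =
      (\<Sum>j\<in>u. tr CARD('f) m (k j) * q j) + p * (\<Sum>j\<in>u. digit_poly (k j div CARD('f) ^ m) * q j)"
    by (simp add: lift_poly_def distrib_right sum.distrib sum_distrib_left mult.assoc)
  then show ?thesis by (simp add: dvd_add_left_iff)
qed

text \<open>The \<open>tr\<close> part has degree below \<open>m\<close>, so
  \<open>lift_poly\<close> is already written as division with remainder by \<open>p\<close>. Both
  parts can be recovered, whence injectivity.\<close>

lemma lift_poly_mod_div:
  assumes p: "degree p = m" "p \<noteq> 0" "1 \<le> m"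
  shows "lift_poly p m k mod p = tr CARD('f) m k" and "lift_poly p m k div p = digit_poly (k div CARD('f) ^ m)"
proof -
  have d: "tr CARD('f) m k = (0 :: 'f poly) \<or> degree (tr CARD('f) m k :: 'f poly) < degree p"
    using len_tr[of "CARD('f)" m k] p by (auto simp: len_def split: if_splits)
  then have tm: "tr CARD('f) m k mod p = tr CARD('f) m k" by (auto simp: mod_poly_less)
  have td: "tr CARD('f) m k div p = 0" using d by (auto simp: div_poly_less)
  show "lift_poly p m k mod p = tr CARD('f) m k" by (simp add: lift_poly_def tm)
  show "lift_poly p m k div p = digit_poly (k div CARD('f) ^ m)"
    using p(2) by (simp add: lift_poly_def td)
qed

lemma lift_poly_inj:
  assumes p: "degree p = m" "p \<noteq> 0" "1 \<le> m" and eq: "lift_poly p m k = lift_poly p m l"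
  shows "k = l"
proof -
  let ?B = "CARD('f) ^ m"
  have "tr CARD('f) m k = (tr CARD('f) m l :: 'f poly)"
    and s: "digit_poly (k div ?B) = (digit_poly (l div ?B) :: 'f poly)"
    using lift_poly_mod_div[OF p] eq by metis+
  then have "digit_poly k = (digit_poly l :: 'f poly)"
    using digit_poly_split[of k m] digit_poly_split[of l m] by simp
  then show ?thesis by (rule digit_poly_inj)
qed

lemma lift_poly_surj:
  assumes p: "degree p = m" "p \<noteq> 0" "1 \<le> m"
  shows "\<exists>k. lift_poly p m k = g"
proof -
  \<comment> \<open>x^m takes the place of \<open>p\<close> in the division of \<open>g\<close> with
    remainder; the coefficients of \<open>h\<close> are the digits of the wanted
    \<open>k\<close>.\<close>
  define h where "h = g mod p + monom 1 m * (g div p)"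
  obtain k where k: "digit_poly k = h" using digit_poly_surj by blast
  have gm: "len (g mod p) \<le> m"
    using degree_mod_less[OF p(2), of g] p(1) by (auto simp: len_def)
  have low: "tr CARD('f) m k = g mod p"
  proof (rule poly_eqI)
    fix i
    have "coeff (tr CARD('f) m k :: 'f poly) i = (if i < m then coeff h i else 0)"
      by (simp add: coeff_tr k[symmetric] coeff_digit_poly)
    also have "\<dots> = coeff (g mod p) i"
      using coeff_len_eq_0[OF gm, of i] by (auto simp: h_def coeff_monom_mult)
    finally show "coeff (tr CARD('f) m k) i = coeff (g mod p) i" .
  qed
  have "monom 1 m * digit_poly (k div CARD('f) ^ m) = monom 1 m * (g div p)"
    using k low digit_poly_split[of k m] by (simp add: h_def)
  then have "digit_poly (k div CARD('f) ^ m) = g div p" by (simp add: monom_eq_0_iff)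
  then have "lift_poly p m k = g" by (simp add: lift_poly_def low add.commute)
  then show ?thesis by blast
qed

end

section \<open>Summation over the dual net\<close>

text \<open>Multiplied by \<open>1 - y\<close>, the partial sum for \<open>Suc t\<close> becomes, by
  Pascal's rule, the partial sum for \<open>t\<close> minus a nonnegative boundary term.\<close>

lemma neg_binomial_sum_le:
  assumes y: "0 \<le> y" "y < (1::real)"
  shows "(\<Sum>\<tau>\<le>T. real ((\<tau> + t) choose t) * y ^ \<tau>) \<le> (1 / (1 - y)) ^ Suc t"
proof (induction t)
  case 0
  have "(1 - y) * (\<Sum>\<tau>\<le>T. y ^ \<tau>) = 1 - y ^ Suc T" by (rule sum_gp_basic)
  also have "\<dots> \<le> 1" using y by simp
  finally show ?case using y by (simp add: field_simps)
next
  case (Suc t)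
  have "(1 - y) * (\<Sum>\<tau>\<le>T. real ((\<tau> + Suc t) choose Suc t) * y ^ \<tau>) =
      (\<Sum>\<tau>\<le>T. real ((\<tau> + t) choose t) * y ^ \<tau>) - real ((T + Suc t) choose Suc t) * y ^ Suc T"
  proof (induction T)
    case (Suc T)
    have "real ((Suc T + Suc t) choose Suc t) = real ((T + Suc t) choose Suc t) + real ((Suc T + t) choose t)"
      by simp
    then show ?case using Suc.IH by (simp add: algebra_simps)
  qed (simp add: algebra_simps)
  also have "\<dots> \<le> (\<Sum>\<tau>\<le>T. real ((\<tau> + t) choose t) * y ^ \<tau>)" using y by simp
  also have "\<dots> \<le> (1 / (1 - y)) ^ Suc t" by (rule Suc.IH)
  finally have "(\<Sum>\<tau>\<le>T. real ((\<tau> + Suc t) choose Suc t) * y ^ \<tau>) \<le> (1 / (1 - y)) ^ Suc t / (1 - y)"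
    using y pos_le_divide_eq[of "1 - y"] by (metis diff_gt_0_iff_gt mult.commute)
  then show ?case by simp
qed

text \<open>\<open>k0\<close> is a dual vector of least \<open>mu_vec\<close>, so its term leads
  back to \<open>rho\<close>. The remaining factor is a negative binomial series in
  \<open>b * x\<close>, multiplied by the counting constants.\<close>

lemma dual_net_sum_le:
  fixes p :: "'f::{field,finite} poly"
  assumes prime: "prime CARD('f)" and u: "finite u" "u \<noteq> {}" and p: "degree p = m" "1 \<le> m"
    and x: "0 < x" "real CARD('f) * x < 1"
  obtains k0 where "k0 \<in> dual_net CARD('f) m p q u"
    and "\<And>F. finite F \<Longrightarrow> F \<subseteq> dual_net CARD('f) m p q u \<Longrightarrow>
      (\<Sum>k\<in>F. x ^ mu_vec CARD('f) u k) \<le> x ^ mu_vec CARD('f) u k0 *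
        (((real CARD('f) - 1) / (1 - real CARD('f) * x)) ^ card u * real (m + 1) ^ (card u - 1))"
proof -
  let ?b = "CARD('f)" and ?D = "dual_net CARD('f) m p q u" and ?n = "card u"
  interpret poly_lattice u "syz p q u" by (rule poly_lattice_syz[OF u(1)])
  have p0: "p \<noteq> 0" using p by auto
  define \<phi> where "\<phi> k = (\<lambda>j. if j \<in> u then lift_poly p m (k j) else 0)" for k
  have b2: "2 \<le> ?b" by (rule CARD_field_ge_2)
  have len\<phi>: "len (lift_poly p m k) = mu ?b k" if "1 \<le> k" for k
    by (rule len_lift_poly[OF prime p(1) p0 that])
  have \<phi>L: "\<phi> k \<in> syz p q u \<longleftrightarrow> p dvd (\<Sum>j\<in>u. tr ?b m (k j) * q j)" for k
    by (simp add: syz_def \<phi>_def lift_poly_cong[OF prime] cong: sum.cong)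
  have \<phi>D: "\<phi> k \<in> syz p q u" "full (\<phi> k)" "wt (\<phi> k) = mu_vec ?b u k" if k: "k \<in> ?D" for k
  proof -
    have k1: "1 \<le> k j" if "j \<in> u" for j using k that by (auto simp: dual_net_def PiE_iff)
    show "\<phi> k \<in> syz p q u" using k by (simp add: \<phi>L dual_net_def cong_0_iff)
    show "full (\<phi> k)" unfolding full_def
    proof
      fix j assume j: "j \<in> u"
      have "0 < mu ?b (k j)" by (simp add: mu_def)
      then have "0 < len (\<phi> k j)" using len\<phi>[OF k1[OF j]] j by (simp add: \<phi>_def del: len_pos_iff)
      then show "\<phi> k j \<noteq> 0" by simp
    qed
    show "wt (\<phi> k) = mu_vec ?b u k"
      unfolding wt_def mu_vec_def
    proof (rule sum.cong)
      fix j assume j: "j \<in> u"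
      then show "len (\<phi> k j) = mu ?b (k j)" using len\<phi>[OF k1[OF j]] by (simp add: \<phi>_def)
    qed simp
  qed
  have inj: "inj_on \<phi> ?D"
  proof (rule inj_onI)
    fix k l assume k: "k \<in> ?D" and l: "l \<in> ?D" and eq: "\<phi> k = \<phi> l"
    have "k j = l j" if "j \<in> u" for j
      using fun_cong[OF eq, of j] that lift_poly_inj[OF prime p(1) p0 p(2)] by (simp add: \<phi>_def)
    then show "k = l"
      using k l unfolding dual_net_def PiE_def by (auto intro: extensionalityI)
  qed
  obtain d where "d \<noteq> 0" "\<forall>t. d dvd t \<longrightarrow> (\<exists>g. (\<forall>j\<in>u. g j \<noteq> 0) \<and>
      p dvd (\<Sum>j\<in>u. g j * q j) - t \<and> (\<Sum>j\<in>u. len (g j)) + degree d \<le> degree p + card u)"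
    using ex_nonzero_solution[OF u(1) p0, of q] by blast
  \<comment> \<open>\<open>t = 0\<close> is a multiple of any \<open>d\<close>. The full vector
    obtained bounds the minimal weight by \<open>m + ?n\<close>.\<close>
  from this(2)[rule_format, of 0] obtain g where g: "\<forall>j\<in>u. g j \<noteq> 0" "p dvd (\<Sum>j\<in>u. g j * q j)"
    "(\<Sum>j\<in>u. len (g j)) \<le> m + ?n"
    using p(1) by auto
  define g1 where "g1 j = (if j \<in> u then g j else 0)" for j
  have g1: "g1 \<in> syz p q u" "full g1" "wt g1 \<le> m + ?n"
    using g by (simp_all add: g1_def syz_def full_def wt_def cong: sum.cong)
  obtain h where h: "h \<in> syz p q u" "full h"
    and min: "\<And>g. g \<in> syz p q u \<Longrightarrow> full g \<Longrightarrow> wt h \<le> wt g"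
    using ex_has_least_nat[of "\<lambda>g. g \<in> syz p q u \<and> full g" g1 wt] g1 by blast
  define M where "M = wt h"
  have Mm: "M \<le> ?n + m" using min[OF g1(1,2)] g1(3) by (simp add: M_def)
  have "(\<Sum>j\<in>u. 1) \<le> wt h" unfolding wt_def
    by (rule sum_mono) (use h(2) in \<open>simp add: full_def Suc_le_eq\<close>)
  then have nM: "?n \<le> M" by (simp add: M_def)
  \<comment> \<open>The lightest full vector is pulled back to the dual net. Its entries are nonzero
    and \<open>lift_poly\<close> sends 0 to 0, so all components of the preimage are
    positive.\<close>
  have "\<forall>j. \<exists>k. lift_poly p m k = h j" using lift_poly_surj[OF prime p(1) p0 p(2)] by blast
  then obtain K where K: "\<And>j. lift_poly p m (K j) = h j" by metis
  define k0 where "k0 = restrict K u"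
  have \<phi>k0: "\<phi> k0 = h"
    using h(1) by (auto simp: \<phi>_def k0_def K syz_def)
  have lift0: "lift_poly p m 0 = 0"
    by (simp add: lift_poly_def[OF prime] tr_def digit_poly_def digit_def)
  have "1 \<le> K j" if "j \<in> u" for j
  proof (rule ccontr)
    assume "\<not> 1 \<le> K j"
    then have "h j = 0" using K[of j] lift0 by (simp add: not_le)
    then show False using h(2) that by (simp add: full_def)
  qed
  then have k0: "k0 \<in> ?D"
    using h(1) \<phi>L[of k0] unfolding \<phi>k0 by (auto simp: dual_net_def cong_0_iff k0_def)
  have Mk0: "mu_vec ?b u k0 = M" using \<phi>D(3)[OF k0] by (simp add: \<phi>k0 M_def)
  have "(\<Sum>k\<in>F. x ^ mu_vec ?b u k) \<le> x ^ M *
      (((real ?b - 1) / (1 - real ?b * x)) ^ ?n * real (m + 1) ^ (?n - 1))"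
    if F: "finite F" "F \<subseteq> ?D" for F
  proof -
    let ?mu = "mu_vec ?b u" and ?t = "?n - 1"
    have ge: "M \<le> ?mu k" if "k \<in> F" for k
      using min[of "\<phi> k"] \<phi>D[of k] that F(2) by (auto simp: M_def)
    define T where "T = (\<Sum>k\<in>F. ?mu k)"
    have "?mu k - M \<le> T" if "k \<in> F" for k
      using member_le_sum[of k F ?mu] that F(1) by (simp add: T_def)
    then have im: "(\<lambda>k. ?mu k - M) ` F \<subseteq> {..T}" by auto
    have "(\<Sum>k\<in>F. x ^ ?mu k) = (\<Sum>\<tau>\<le>T. \<Sum>k | k \<in> F \<and> ?mu k - M = \<tau>. x ^ ?mu k)"
      by (rule sum.group[symmetric, OF F(1) finite_atMost im])
    also have "\<dots> = (\<Sum>\<tau>\<le>T. real (card {k\<in>F. ?mu k - M = \<tau>}) * x ^ (M + \<tau>))"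
    proof (rule sum.cong)
      fix \<tau>
      have "(\<Sum>k | k \<in> F \<and> ?mu k - M = \<tau>. x ^ ?mu k) = (\<Sum>k | k \<in> F \<and> ?mu k - M = \<tau>. x ^ (M + \<tau>))"
        by (rule sum.cong) (use ge in auto)
      then show "(\<Sum>k | k \<in> F \<and> ?mu k - M = \<tau>. x ^ ?mu k) =
          real (card {k\<in>F. ?mu k - M = \<tau>}) * x ^ (M + \<tau>)" by simp
    qed simp
    also have "\<dots> \<le> (\<Sum>\<tau>\<le>T. real ((?b - 1) ^ ?n * ?b ^ \<tau> * ((\<tau> + ?t) choose ?t) * (m + 1) ^ ?t) * x ^ (M + \<tau>))"
    proof (intro sum_mono mult_right_mono)
      fix \<tau>
      have "card {k\<in>F. ?mu k - M = \<tau>} \<le> card {g\<in>syz p q u. full g \<and> wt g = M + \<tau>}"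
      proof (rule card_inj_on_le)
        show "inj_on \<phi> {k\<in>F. ?mu k - M = \<tau>}" by (rule inj_on_subset[OF inj]) (use F in auto)
        show "\<phi> ` {k\<in>F. ?mu k - M = \<tau>} \<subseteq> {g\<in>syz p q u. full g \<and> wt g = M + \<tau>}"
          using \<phi>D ge F(2) by fastforce
        show "finite {g\<in>syz p q u. full g \<and> wt g = M + \<tau>}" by (rule card_full_wt_le(1)[OF u(2)])
      qed
      also have "\<dots> \<le> (?b - 1) ^ ?n * ?b ^ \<tau> * ((\<tau> + ?t) choose ?t) * (m + 1) ^ ?t"
        by (rule card_full_wt_bound[OF u(2) _ nM Mm]) (simp add: M_def min)
      finally show "real (card {k\<in>F. ?mu k - M = \<tau>}) \<le>
          real ((?b - 1) ^ ?n * ?b ^ \<tau> * ((\<tau> + ?t) choose ?t) * (m + 1) ^ ?t)"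
        by (simp only: of_nat_le_iff)
    qed (use x in simp)
    also have "\<dots> = x ^ M * (real (?b - 1) ^ ?n * real (m + 1) ^ ?t) *
        (\<Sum>\<tau>\<le>T. real ((\<tau> + ?t) choose ?t) * (real ?b * x) ^ \<tau>)"
      by (simp add: sum_distrib_left power_add power_mult_distrib mult_ac)
    also have "\<dots> \<le> x ^ M * (real (?b - 1) ^ ?n * real (m + 1) ^ ?t) * (1 / (1 - real ?b * x)) ^ Suc ?t"
      using x by (intro mult_left_mono neg_binomial_sum_le) auto
    also have "Suc ?t = ?n" using u by (simp add: card_gt_0_iff)
    also have "real (?b - 1) = real ?b - 1" using b2 by (simp add: of_nat_diff)
    also have "x ^ M * ((real ?b - 1) ^ ?n * real (m + 1) ^ ?t) * (1 / (1 - real ?b * x)) ^ ?n =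
        x ^ M * (((real ?b - 1) / (1 - real ?b * x)) ^ ?n * real (m + 1) ^ ?t)"
      by (simp add: power_divide)
    finally show ?thesis .
  qed
  then show ?thesis using that[OF k0] Mk0 by simp
qed

lemma infsum_ennreal_le:
  fixes f :: "'a \<Rightarrow> real"
  assumes "\<And>k. k \<in> A \<Longrightarrow> 0 \<le> f k" and "\<And>F. finite F \<Longrightarrow> F \<subseteq> A \<Longrightarrow> (\<Sum>k\<in>F. f k) \<le> B"
  shows "(\<Sum>\<^sub>\<infinity>k\<in>A. ennreal (f k)) \<le> ennreal B"
proof (rule infsum_le_finite_sums)
  show "(\<lambda>k. ennreal (f k)) summable_on A" by (simp add: nonneg_summable_on_complete)
  fix F assume F: "finite F" "F \<subseteq> A"
  have "(\<Sum>k\<in>F. ennreal (f k)) = ennreal (\<Sum>k\<in>F. f k)"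
    by (rule sum_ennreal) (use assms(1) F in auto)
  then show "(\<Sum>k\<in>F. ennreal (f k)) \<le> ennreal B" using assms(2)[OF F] by (simp add: ennreal_leI)
qed

section \<open>The weights and the passage from \<alpha> to \<alpha>'\<close>

theorem theorem3:
  fixes b s m :: nat
    and p :: "'f::{field, finite} poly"
    and q :: "nat \<Rightarrow> 'f poly"
    and \<alpha> \<alpha>' :: real
    and \<gamma> \<gamma>' :: "nat set \<Rightarrow> real"
  assumes "prime b" and "CARD('f) = b"
    and "s \<ge> 1" and "m \<ge> 1"
    and "degree p = m"
    and "q \<in> {1..s} \<rightarrow> G_poly m - {0}"
    and "\<alpha> > 1/2" and "\<alpha>' > 1/2"
    and "\<And>u. finite u \<Longrightarrow> u \<noteq> {} \<Longrightarrow> u \<subseteq> {1..} \<Longrightarrow> \<gamma> u \<ge> 0"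
    and "\<And>u. finite u \<Longrightarrow> u \<noteq> {} \<Longrightarrow> u \<subseteq> {1..} \<Longrightarrow> \<gamma>' u \<ge> 0"
  shows "P_err b s m p \<alpha>' \<gamma>' q \<le>
    (if \<exists>u\<in>index_sets s. \<gamma> u = 0 \<and> \<gamma>' u > 0 then \<infinity>
     else ennreal (rho b s m p \<alpha> \<gamma> q powr (\<alpha>' / \<alpha>) *
       (\<Sum>u\<in>index_sets s. \<gamma>' u / \<gamma> u powr (\<alpha>' / \<alpha>)
          * (real b powr (2 * \<alpha>' - 1) * (real b - 1) / (real b powr (2 * \<alpha>' - 1) - 1)) ^ card u
          * real (m + 1) ^ (card u - 1))))"
proof (cases "\<exists>u\<in>index_sets s. \<gamma> u = 0 \<and> \<gamma>' u > 0")
  case True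
  then show ?thesis by simp
next
  case False
  note [simp] = assms(2)
  define R where "R = rho b s m p \<alpha> \<gamma> q powr (\<alpha>' / \<alpha>)"
  define C where "C = real b powr (2 * \<alpha>' - 1) * (real b - 1) / (real b powr (2 * \<alpha>' - 1) - 1)"
  define x where "x = real b powr (- 2 * \<alpha>')"
  define T where "T u = \<gamma>' u / \<gamma> u powr (\<alpha>' / \<alpha>) * C ^ card u * real (m + 1) ^ (card u - 1)" for u
  have b2: "2 \<le> b" using assms(1) by (simp add: prime_ge_2_nat)
  have x0: "0 < x" using b2 by (simp add: x_def)
  have y: "real b * x = 1 / real b powr (2 * \<alpha>' - 1)"
  proof -
    have "real b * x = real b powr (1 + - 2 * \<alpha>')" unfolding x_def powr_add using b2 by simp
    also have "\<dots> = real b powr - (2 * \<alpha>' - 1)" by simp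
    finally show ?thesis by (simp only: powr_minus_divide)
  qed
  \<comment> \<open>Here \<alpha>' > 1/2 gives \<open>b * x < 1\<close>, the condition for
    convergence.\<close>
  have B1: "1 < real b powr (2 * \<alpha>' - 1)" using b2 assms(8) by (intro gr_one_powr) auto
  have y1: "real b * x < 1" unfolding y using B1 by (simp only: divide_less_eq_1 less_trans[OF zero_less_one] simp_thms)
  have C: "(real b - 1) / (1 - real b * x) = C" unfolding y C_def using B1 b2 by (simp add: field_simps)
  have C0: "0 \<le> C" using B1 b2 by (simp add: C_def)
  have fin: "finite (index_sets s)" by (simp add: index_sets_def)
  have main: "(\<Sum>\<^sub>\<infinity>k\<in>dual_net b m p q u. ennreal (r_val b \<alpha>' \<gamma>' u k)) \<le> ennreal (R * T u)"
    and T0: "0 \<le> T u" if u: "u \<in> index_sets s" for u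
  proof -
    have uf: "finite u" "u \<noteq> {}" "u \<subseteq> {1..}"
      using u by (auto simp: index_sets_def intro: finite_subset)
    have \<gamma>0: "0 \<le> \<gamma> u" "0 \<le> \<gamma>' u" using assms(9,10) uf by auto
    show "0 \<le> T u" using \<gamma>0 C0 by (simp add: T_def)
    have rv: "r_val b \<alpha>' \<gamma>' u k = \<gamma>' u * x ^ mu_vec b u k" for k
      unfolding r_val_def x_def using b2 by (simp add: powr_power mult_ac)
    have prime': "prime CARD('f)" using assms(1) by simp
    obtain k0 where k0: "k0 \<in> dual_net b m p q u" and sum: "\<And>F. finite F \<Longrightarrow> F \<subseteq> dual_net b m p q u \<Longrightarrow>
      (\<Sum>k\<in>F. x ^ mu_vec b u k) \<le> x ^ mu_vec b u k0 * (C ^ card u * real (m + 1) ^ (card u - 1))"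
      using dual_net_sum_le[OF prime' uf(1,2) assms(5,4) x0, of q] y1 C by auto
    show "(\<Sum>\<^sub>\<infinity>k\<in>dual_net b m p q u. ennreal (r_val b \<alpha>' \<gamma>' u k)) \<le> ennreal (R * T u)"
      unfolding rv
    proof (rule infsum_ennreal_le)
      show "0 \<le> \<gamma>' u * x ^ mu_vec b u k" for k using \<gamma>0 x0 by simp
      fix F assume F: "finite F" "F \<subseteq> dual_net b m p q u"
      have "(\<Sum>k\<in>F. \<gamma>' u * x ^ mu_vec b u k) = \<gamma>' u * (\<Sum>k\<in>F. x ^ mu_vec b u k)"
        by (simp add: sum_distrib_left)
      also have "\<dots> \<le> \<gamma>' u * (x ^ mu_vec b u k0 * (C ^ card u * real (m + 1) ^ (card u - 1)))"
        by (intro mult_left_mono sum F \<gamma>0)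
      also have "\<dots> \<le> R * T u"
      \<comment> \<open>If \<open>\<gamma>' u = 0\<close>, both sides are 0, in accordance with the
        convention 0/0 = 0. Otherwise the excluded case leaves \<open>\<gamma> u > 0\<close>, and
        division by its power is legitimate.\<close>
      proof (cases "\<gamma>' u = 0")
        case True
        then show ?thesis by (simp add: T_def)
      next
        case ne: False
        then have \<gamma>u: "0 < \<gamma> u" using False u \<gamma>0 by force
        have "\<gamma> u * real b powr (- 2 * \<alpha> * real (mu_vec b u k0)) \<le> rho b s m p \<alpha> \<gamma> q"
        proof -
          have \<alpha>0: "0 < \<alpha>" using assms(7) by simp
          obtain k where "k \<in> dual_net b m p q u" and k: "\<And>l. l \<in> dual_net b m p q u \<Longrightarrow> r_val b \<alpha> \<gamma> u l \<le> r_val b \<alpha> \<gamma> u k"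
            and Sup: "(SUP l\<in>dual_net b m p q u. r_val b \<alpha> \<gamma> u l) = r_val b \<alpha> \<gamma> u k"
            by (rule r_max_attained[where \<gamma> = \<gamma> and u = u and m = m and p = p and q = q,
                OF b2 \<alpha>0 \<gamma>0(1)]) blast
          have "r_val b \<alpha> \<gamma> u k0 \<le> (SUP l\<in>dual_net b m p q u. r_val b \<alpha> \<gamma> u l)"
            using k[OF k0] Sup by simp
          also have "\<dots> \<le> rho b s m p \<alpha> \<gamma> q"
            unfolding rho_def by (rule Max_ge) (use fin u in auto)
          finally show ?thesis by (simp add: r_val_def)
        qed
        \<comment> \<open>The power \<alpha>'/\<alpha> turns the term of \<open>k0\<close> for
          \<alpha> into \<open>\<gamma> u powr (\<alpha>' / \<alpha>)\<close> times
          \<open>x ^ mu_vec b u k0\<close>.\<close>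
        then have "(\<gamma> u * real b powr (- 2 * \<alpha> * real (mu_vec b u k0))) powr (\<alpha>' / \<alpha>) \<le> R"
          unfolding R_def using \<gamma>0 assms(7,8) by (intro powr_mono2) auto
        also have "(\<gamma> u * real b powr (- 2 * \<alpha> * real (mu_vec b u k0))) powr (\<alpha>' / \<alpha>) =
            \<gamma> u powr (\<alpha>' / \<alpha>) * real b powr (- 2 * \<alpha>' * real (mu_vec b u k0))"
          using \<gamma>0 assms(7) by (simp add: powr_mult powr_powr mult_ac)
        also have "real b powr (- 2 * \<alpha>' * real (mu_vec b u k0)) = x ^ mu_vec b u k0"
          using b2 by (simp add: x_def powr_power mult_ac)
        finally have "x ^ mu_vec b u k0 \<le> R / \<gamma> u powr (\<alpha>' / \<alpha>)"
          using \<gamma>u by (simp add: field_simps)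
        then have "\<gamma>' u * (x ^ mu_vec b u k0 * (C ^ card u * real (m + 1) ^ (card u - 1))) \<le>
            \<gamma>' u * (R / \<gamma> u powr (\<alpha>' / \<alpha>) * (C ^ card u * real (m + 1) ^ (card u - 1)))"
          using \<gamma>0 C0 by (intro mult_left_mono mult_right_mono) auto
        then show ?thesis by (simp add: T_def mult_ac)
      qed
      finally show "(\<Sum>k\<in>F. \<gamma>' u * x ^ mu_vec b u k) \<le> R * T u" .
    qed
  qed
  have R0: "0 \<le> R" by (simp add: R_def)
  have "P_err b s m p \<alpha>' \<gamma>' q \<le> (\<Sum>u\<in>index_sets s. ennreal (R * T u))"
    unfolding P_err_def by (rule sum_mono) (rule main)
  also have "\<dots> = ennreal (\<Sum>u\<in>index_sets s. R * T u)"
    by (rule sum_ennreal) (use R0 T0 in simp)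
  also have "(\<Sum>u\<in>index_sets s. R * T u) = R * (\<Sum>u\<in>index_sets s. T u)"
    by (simp add: sum_distrib_left)
  finally show ?thesis using False by (simp only: R_def T_def C_def if_False)
qed

end
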